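(* Let $U_4=\{x\in\mathbb{R}^4: Ax\ge b\}$ with $A=\begin{pmatrix}-6&-3&0&1\\-3&-6&1&0\\-35&-45&6&3\\-45&-35&3&6\\1&0&0&0\\0&1&0&0\\0&0&1&0\\0&0&0&1\end{pmatrix}$, $b=(-1,-1,-8,-8,0,0,0,0)^T$ (the Klee–Walkup polyhedron, a $4$-dimensional unbounded polyhedron with $8$ facets). Then every $4$-dimensional polyhedron combinatorially equivalent to $U_4$ (i.e. every realization of $U_4$, given by an irredundant inequality system) has circuit diameter at most $4$.
   Context: For a polyhedron $P=\{x: A'x\ge b'\}$ given irredundantly, the circuits are the nonzero vectors $g$ such that the support of $A'g$ is inclusion-minimal among supports of $A'x$, $x\ne0$, normalized to coprime integers. A circuit walk is a sequence $y^{(0)},\dots,y^{(k)}$ in $P$ with $y^{(i+1)}-y^{(i)}=\alpha_i g^{(i)}$, $g^{(i)}$ a circuit, $\alpha_i>0$, and $y^{(i)}+\alpha g^{(i)}\notin P$ for all $\alpha>\alpha_i$; its length is $k$. The circuit diameter is the maximum over ordered pairs of vertices of the minimum length of a circuit walk from the first to the second. Two polyhedra are combinatorially equivalent if their face lattices are isomorphic. *)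

theory Defs
  imports "HOL-Analysis.Analysis" "HOL-Library.Extended_Nat"
begin

definition polyhedron_of :: "real^'n^'m \<Rightarrow> real^'m \<Rightarrow> (real^'n) set" where
  "polyhedron_of A b = {x. \<forall>i. (A *v x) $ i \<ge> b $ i}"

definition irredundant :: "real^'n^'m \<Rightarrow> real^'m \<Rightarrow> bool" where
  "irredundant A b \<longleftrightarrow>
     (\<forall>i. {x. \<forall>j. j \<noteq> i \<longrightarrow> (A *v x) $ j \<ge> b $ j} \<noteq> polyhedron_of A b)"

definition support :: "real^'m \<Rightarrow> 'm set" where
  "support v = {i. v $ i \<noteq> 0}"

definition coprime_integral :: "real^'n \<Rightarrow> bool" where
  "coprime_integral g \<longleftrightarrow>
     (\<exists>z :: 'n \<Rightarrow> int. (\<forall>j. g $ j = of_int (z j)) \<and> Gcd (range z) = 1)"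

text \<open>
  The last conjunct is the normalization to coprime integers. It applies whenever the
  line through \<open>g\<close> contains a nonzero integral vector; this is always the case for a
  circuit of a rational matrix of full column rank. For an irrational matrix the line may
  contain no such vector, and then every nonzero multiple counts as a circuit. The
  choice of representative has no influence on circuit walks, because step lengths are
  arbitrary positive reals.
\<close>

definition is_circuit :: "real^'n^'m \<Rightarrow> real^'n \<Rightarrow> bool" where
  "is_circuit A g \<longleftrightarrow>
     g \<noteq> 0 \<and>
     (\<nexists>x. x \<noteq> 0 \<and> support (A *v x) \<subset> support (A *v g)) \<and>
     ((\<exists>c. coprime_integral (c *\<^sub>R g)) \<longrightarrow> coprime_integral g)"

definition circuit_step :: "real^'n^'m \<Rightarrow> real^'m \<Rightarrow> real^'n \<Rightarrow> real^'n \<Rightarrow> bool" where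
  "circuit_step A b y y' \<longleftrightarrow>
     (\<exists>g \<alpha>. is_circuit A g \<and> \<alpha> > 0 \<and> y' - y = \<alpha> *\<^sub>R g \<and>
        (\<forall>\<beta>>\<alpha>. y + \<beta> *\<^sub>R g \<notin> polyhedron_of A b))"

definition circuit_walk :: "real^'n^'m \<Rightarrow> real^'m \<Rightarrow> nat \<Rightarrow> (nat \<Rightarrow> real^'n) \<Rightarrow> bool" where
  "circuit_walk A b k y \<longleftrightarrow>
     (\<forall>i\<le>k. y i \<in> polyhedron_of A b) \<and> (\<forall>i<k. circuit_step A b (y i) (y (Suc i)))"

text \<open>The value is \<open>\<infinity>\<close> if there is no circuit walk from \<open>u\<close> to \<open>v\<close>.\<close>

definition circuit_distance :: "real^'n^'m \<Rightarrow> real^'m \<Rightarrow> real^'n \<Rightarrow> real^'n \<Rightarrow> enat" where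
  "circuit_distance A b u v =
     Inf {enat k | k. \<exists>y. circuit_walk A b k y \<and> y 0 = u \<and> y k = v}"

definition circuit_diameter :: "real^'n^'m \<Rightarrow> real^'m \<Rightarrow> enat" where
  "circuit_diameter A b =
     Sup {circuit_distance A b u v | u v.
            u extreme_point_of polyhedron_of A b \<and> v extreme_point_of polyhedron_of A b}"

text \<open>
  An order isomorphism of face lattices is a lattice isomorphism. Both the empty face
  and the polyhedron itself are faces.
\<close>

definition combinatorially_equivalent ::
    "'a::euclidean_space set \<Rightarrow> 'b::euclidean_space set \<Rightarrow> bool" where
  "combinatorially_equivalent P Q \<longleftrightarrow>
     (\<exists>f. bij_betw f {F. F face_of P} {F. F face_of Q} \<and>
        (\<forall>F G. F face_of P \<longrightarrow> G face_of P \<longrightarrow> (F \<subseteq> G \<longleftrightarrow> f F \<subseteq> f G)))"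

definition KW_A :: "real^4^8" where
  "KW_A = vector
     [vector [ -6,  -3, 0, 1],
      vector [ -3,  -6, 1, 0],
      vector [-35, -45, 6, 3],
      vector [-45, -35, 3, 6],
      vector [1, 0, 0, 0],
      vector [0, 1, 0, 0],
      vector [0, 0, 1, 0],
      vector [0, 0, 0, 1]]"

definition KW_b :: "real^8" where
  "KW_b = vector [-1, -1, -8, -8, 0, 0, 0, 0]"

definition U4 :: "(real^4) set" where
  "U4 = polyhedron_of KW_A KW_b"

lemma forall_8: "(\<forall>i::8. P i) \<longleftrightarrow> P 1 \<and> P 2 \<and> P 3 \<and> P 4 \<and> P 5 \<and> P 6 \<and> P 7 \<and> P 8"
proof -
  have "i \<in> {1,2,3,4,5,6,7,8}" for i :: 8
  proof (induct i)
    case (of_int z)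
    then have "z \<in> {0,1,2,3,4,5,6,7}" by auto
    then show ?case by auto
  qed
  then show ?thesis by (metis empty_iff insert_iff)
qed

lemma mem_U4_iff:
  "x \<in> U4 \<longleftrightarrow>
     - 6 * x$1 - 3 * x$2 + x$4 \<ge> -1 \<and>
     - 3 * x$1 - 6 * x$2 + x$3 \<ge> -1 \<and>
     - 35 * x$1 - 45 * x$2 + 6 * x$3 + 3 * x$4 \<ge> -8 \<and>
     - 45 * x$1 - 35 * x$2 + 3 * x$3 + 6 * x$4 \<ge> -8 \<and>
     x$1 \<ge> 0 \<and> x$2 \<ge> 0 \<and> x$3 \<ge> 0 \<and> x$4 \<ge> 0"
  by (simp add: U4_def polyhedron_of_def forall_8 KW_A_def KW_b_def
      matrix_vector_mult_def sum_4 vector_def algebra_simps)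

end

theory Submission
  imports Defs
begin

text \<open>
  A one-dimensional face is a circuit direction in every realization, so edge walks are
  circuit walks, and in the graph of \<open>U4\<close> the only vertices at distance five are \<open>1234\<close> and
  \<open>5678\<close> (vertices being named by their facets). Between these two, an edge walk of length two
  leads from \<open>5678\<close> to \<open>1478\<close>, which lies together with \<open>1234\<close> on the unbounded two-dimensional
  face \<open>14\<close>. There three edges can be replaced by two circuit steps: move parallel to the
  middle one of them until the boundary is hit; this happens on the last of the three edges or
  on the ray after it, and a second step reaches \<open>1234\<close>. The other direction uses the face
  \<open>58\<close> in the same way. Everything used about a realization is read off its face lattice,
  because a lattice isomorphism between pointed polyhedra preserves dimensions.
\<close>

subsection \<open>Faces of polyhedra\<close>

definition linefree :: "'a::real_vector set \<Rightarrow> bool" where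
  "linefree S \<longleftrightarrow> (\<forall>x d. (\<forall>t::real. x + t *\<^sub>R d \<in> S) \<longrightarrow> d = 0)"

lemma linefreeD:
  assumes "linefree S" "\<And>t::real. x + t *\<^sub>R d \<in> S"
  shows "d = 0"
  using assms(1)[unfolded linefree_def, THEN spec, THEN spec, of x d] assms(2) by simp

lemma linefreeI:
  assumes "\<And>x d. (\<And>t::real. x + t *\<^sub>R d \<in> S) \<Longrightarrow> d = 0"
  shows "linefree S"
  unfolding linefree_def
proof (intro allI impI)
  fix x d assume "\<forall>t::real. x + t *\<^sub>R d \<in> S"
  then have "x + t *\<^sub>R d \<in> S" for t :: real by simp
  then show "d = 0" by (rule assms)
qed

lemma linefree_subset:
  assumes "linefree S" "T \<subseteq> S"
  shows "linefree T"
proof (rule linefreeI)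
  fix x d assume "x + t *\<^sub>R d \<in> T" for t :: real
  then have "x + t *\<^sub>R d \<in> S" for t :: real using assms(2) by (rule subsetD[rotated])
  with assms(1) show "d = 0" by (rule linefreeD)
qed

lemma codim_1_face_exists:
  fixes S :: "'a::euclidean_space set"
  assumes "polyhedron S" "linefree S" "S \<noteq> {}"
  obtains G where "G face_of S" "G \<noteq> S" "aff_dim G = aff_dim S - 1"
proof (cases "rel_frontier S = {}")
  case True
  then have aff: "affine S" by (simp add: rel_frontier_eq_empty)
  obtain x where x: "x \<in> S" using assms(3) by auto
  have "y = x" if "y \<in> S" for y
  proof -
    have "x + t *\<^sub>R (y - x) \<in> S" for t :: real
      using mem_affine[OF aff x that, of "1 - t" t] by (simp add: algebra_simps)
    with assms(2) have "y - x = 0" by (rule linefreeD)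
    then show ?thesis by simp
  qed
  with x have "S = {x}" by blast
  then have "{} face_of S" "{} \<noteq> S" "aff_dim ({}::'a set) = aff_dim S - 1"
    by simp_all
  then show ?thesis by (rule that)
next
  case False
  then obtain G where "G facet_of S"
    by (auto simp: rel_frontier_of_polyhedron[OF assms(1)])
  then have "G face_of S" "aff_dim G = aff_dim S - 1" by (simp_all add: facet_of_def)
  moreover from this have "G \<noteq> S" by auto
  ultimately show ?thesis by (intro that)
qed

definition face_iso :: "('a::real_vector set \<Rightarrow> 'b::real_vector set) \<Rightarrow> 'a set \<Rightarrow> 'b set \<Rightarrow> bool" where
  "face_iso h P Q \<longleftrightarrow> bij_betw h {F. F face_of P} {F. F face_of Q} \<and>
     (\<forall>F G. F face_of P \<longrightarrow> G face_of P \<longrightarrow> (F \<subseteq> G \<longleftrightarrow> h F \<subseteq> h G))"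

lemma face_iso_face: "face_iso h P Q \<Longrightarrow> F face_of P \<Longrightarrow> h F face_of Q"
  unfolding face_iso_def bij_betw_def by auto

lemma face_iso_subset_iff:
  "face_iso h P Q \<Longrightarrow> F face_of P \<Longrightarrow> G face_of P \<Longrightarrow> h F \<subseteq> h G \<longleftrightarrow> F \<subseteq> G"
  unfolding face_iso_def by auto

lemma face_iso_eq_iff:
  "face_iso h P Q \<Longrightarrow> F face_of P \<Longrightarrow> G face_of P \<Longrightarrow> h F = h G \<longleftrightarrow> F = G"
  by (simp add: set_eq_subset face_iso_subset_iff)

lemma face_iso_surj:
  assumes "face_iso h P Q" "G face_of Q"
  obtains F where "F face_of P" "h F = G"
  using assms unfolding face_iso_def bij_betw_def by (metis (mono_tags) imageE mem_Collect_eq)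

lemma face_iso_empty:
  assumes "face_iso h P Q"
  shows "h {} = {}"
proof -
  obtain F where "F face_of P" "h F = {}" by (rule face_iso_surj[OF assms empty_face_of])
  then show ?thesis using face_iso_subset_iff[OF assms, of "{}" F] by auto
qed

lemma face_iso_inverse:
  assumes "face_iso h P Q"
  obtains k where "face_iso k Q P" "\<forall>F. F face_of P \<longrightarrow> k (h F) = F"
proof -
  have bij: "bij_betw h {F. F face_of P} {F. F face_of Q}" using assms by (simp add: face_iso_def)
  define k where "k = the_inv_into {F. F face_of P} h"
  have kh: "k (h F) = F" if "F face_of P" for F
    using the_inv_into_f_f[OF bij_betw_imp_inj_on[OF bij]] that by (simp add: k_def)
  have hk: "h (k G) = G" if "G face_of Q" for G
    using f_the_inv_into_f_bij_betw[OF bij] that by (simp add: k_def)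
  have bijk: "bij_betw k {F. F face_of Q} {F. F face_of P}"
    unfolding k_def by (rule bij_betw_the_inv_into[OF bij])
  then have kface: "k G face_of P" if "G face_of Q" for G
    using that by (auto simp: bij_betw_def)
  have "face_iso k Q P"
    unfolding face_iso_def
    using bijk face_iso_subset_iff[OF assms kface kface] hk by auto
  moreover have "\<forall>F. F face_of P \<longrightarrow> k (h F) = F" using kh by simp
  ultimately show ?thesis by (rule that)
qed

lemma combinatorially_equivalent_iff: "combinatorially_equivalent P Q \<longleftrightarrow> (\<exists>h. face_iso h P Q)"
  by (simp add: combinatorially_equivalent_def face_iso_def)

lemma aff_dim_face_iso_le:
  fixes P :: "'a::euclidean_space set" and Q :: "'b::euclidean_space set"
  assumes P: "polyhedron P" "linefree P" and Q: "polyhedron Q" and iso: "face_iso h Q P"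
  shows "F face_of Q \<Longrightarrow> aff_dim (h F) \<le> aff_dim F"
proof (induction "nat (aff_dim F + 1)" arbitrary: F rule: less_induct)
  case less
  show ?case
  proof (cases "h F = {}")
    case True
    then show ?thesis by (simp add: aff_dim_geq)
  next
    case False
    have hF: "h F face_of P" using iso less.prems by (rule face_iso_face)
    have "polyhedron (h F)" using P(1) hF by (rule face_of_polyhedron_polyhedron)
    moreover have "linefree (h F)"
      using P(2) face_of_imp_subset[OF hF] by (rule linefree_subset)
    ultimately obtain G where G: "G face_of h F" "G \<noteq> h F" "aff_dim G = aff_dim (h F) - 1"
      using codim_1_face_exists[OF _ _ False] by metis
    have GP: "G face_of P" using G(1) hF by (rule face_of_trans)
    then obtain G' where G': "G' face_of Q" "h G' = G" by (rule face_iso_surj[OF iso])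
    have sub: "G' \<subseteq> F"
      using face_iso_subset_iff[OF iso G'(1) less.prems] G'(2) face_of_imp_subset[OF G(1)] by simp
    have "G' face_of F"
      using G'(1) sub face_of_imp_subset[OF less.prems] by (rule face_of_subset)
    moreover have "G' \<noteq> F" using G' G(2) by auto
    moreover have "convex F" using less.prems by (rule face_of_imp_convex)
    ultimately have lt: "aff_dim G' < aff_dim F" using face_of_aff_dim_lt by blast
    then have "aff_dim (h G') \<le> aff_dim G'"
      using less.hyps[OF _ G'(1)] aff_dim_geq[of G'] by linarith
    then show ?thesis using lt G(3) G'(2) by simp
  qed
qed

lemma polyhedron_face_functional:
  fixes P :: "'a::euclidean_space set"
  assumes "polyhedron P" "T face_of P"
  obtains a b where "\<And>x. x \<in> P \<Longrightarrow> b \<le> a \<bullet> x" "\<And>x. x \<in> P \<Longrightarrow> x \<in> T \<longleftrightarrow> a \<bullet> x = b"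
proof -
  have "T exposed_face_of P" using assms by (simp add: exposed_face_of_polyhedron)
  then obtain a b where "P \<subseteq> {x. a \<bullet> x \<le> b}" "T = P \<inter> {x. a \<bullet> x = b}"
    unfolding exposed_face_of_def by auto
  then show ?thesis using that[of "-b" "-a"] by auto
qed

lemma mem_line_of_aff_dim_le_1:
  fixes G :: "'a::euclidean_space set"
  assumes "aff_dim G \<le> 1" "x \<in> G" "y \<in> G" "x \<noteq> y" "w \<in> G"
  shows "\<exists>u. w = x + u *\<^sub>R (y - x)"
proof -
  have "affine hull {x, y} = affine hull G"
  proof (rule affine_dim_equal)
    show "affine hull {x, y} \<subseteq> affine hull G" using assms by (intro hull_mono) auto
    then show "aff_dim (affine hull {x, y}) = aff_dim (affine hull G)"
      using assms(1,4) aff_dim_subset[of "affine hull {x, y}" "affine hull G"] by (simp add: aff_dim_2)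
  qed auto
  then have "w \<in> affine hull {x, y}" using hull_inc[OF assms(5)] by simp
  then show ?thesis by (auto simp: affine_hull_2_alt)
qed

lemma mem_plane_of_aff_dim_le_2:
  fixes F :: "'a::euclidean_space set"
  assumes dim: "aff_dim F \<le> 2" and mem: "p \<in> F" "x \<in> F" "y \<in> F" "w \<in> F"
    and indep: "p \<noteq> x" "c \<bullet> p = c \<bullet> x" "c \<bullet> p \<noteq> c \<bullet> y"
  shows "\<exists>\<alpha> \<beta>. w = p + \<alpha> *\<^sub>R (x - p) + \<beta> *\<^sub>R (y - p)"
proof -
  have "y \<notin> affine hull {p, x}"
    using indep by (auto simp: affine_hull_2_alt inner_simps)
  then have d: "aff_dim {y, p, x} = 2"
    using indep(1) by (simp add: aff_dim_insert[of y] aff_dim_2)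
  have "affine hull {y, p, x} = affine hull F"
  proof (rule affine_dim_equal)
    show "affine hull {y, p, x} \<subseteq> affine hull F" using mem by (intro hull_mono) auto
    then show "aff_dim (affine hull {y, p, x}) = aff_dim (affine hull F)"
      using dim d aff_dim_subset[of "affine hull {y, p, x}" "affine hull F"] by simp
  qed auto
  then have "w \<in> affine hull {y, p, x}" using hull_inc[OF mem(4)] by simp
  then obtain s t u where "w = s *\<^sub>R y + t *\<^sub>R p + u *\<^sub>R x" "s + t + u = 1"
    unfolding affine_hull_3 by blast
  moreover from this have "t = 1 - s - u" by simp
  ultimately have "w = p + u *\<^sub>R (x - p) + s *\<^sub>R (y - p)" by (simp add: algebra_simps)
  then show ?thesis by blast
qed

lemma convex_line:
  fixes x y :: "'a::real_vector"
  assumes "convex S" "x \<in> S" "y \<in> S" "0 \<le> u" "u \<le> 1"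
  shows "x + u *\<^sub>R (y - x) \<in> S"
  using convexD_alt[OF assms(1-3), of u] assms(4,5) by (simp add: algebra_simps)

lemma in_open_segment_line:
  fixes x d :: "'a::real_vector"
  assumes "s < t" "t < u" "d \<noteq> 0"
  shows "x + t *\<^sub>R d \<in> open_segment (x + s *\<^sub>R d) (x + u *\<^sub>R d)"
proof -
  define l where "l = (t - s) / (u - s)"
  have "0 < l" "l < 1" using assms by (auto simp: l_def)
  have t: "(1 - l) * s + l * u = t"
  proof -
    have "l * (u - s) = t - s" using assms by (simp add: l_def)
    then show ?thesis by (simp add: algebra_simps)
  qed
  have "(1 - l) *\<^sub>R (x + s *\<^sub>R d) + l *\<^sub>R (x + u *\<^sub>R d) = x + ((1 - l) * s + l * u) *\<^sub>R d"
    by (simp add: algebra_simps)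
  also have "\<dots> = x + t *\<^sub>R d" unfolding t ..
  finally have "x + t *\<^sub>R d = (1 - l) *\<^sub>R (x + s *\<^sub>R d) + l *\<^sub>R (x + u *\<^sub>R d)" ..
  moreover have "x + s *\<^sub>R d \<noteq> x + u *\<^sub>R d" using assms by simp
  ultimately show ?thesis unfolding in_segment using \<open>0 < l\<close> \<open>l < 1\<close> by blast
qed

lemma face_of_line_extend:
  assumes "T face_of P" "x + s *\<^sub>R d \<in> P" "x + u *\<^sub>R d \<in> P" "x + t *\<^sub>R d \<in> T" "s < t" "t < u"
  shows "x + s *\<^sub>R d \<in> T" "x + u *\<^sub>R d \<in> T"
proof -
  have "x + s *\<^sub>R d \<in> T \<and> x + u *\<^sub>R d \<in> T"
  proof (cases "d = 0")
    case True
    then show ?thesis using assms(4) by simp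
  next
    case False
    with assms(5,6) have "x + t *\<^sub>R d \<in> open_segment (x + s *\<^sub>R d) (x + u *\<^sub>R d)"
      by (rule in_open_segment_line)
    from face_ofD[OF assms(1) this assms(2-4)] show ?thesis .
  qed
  then show "x + s *\<^sub>R d \<in> T" "x + u *\<^sub>R d \<in> T" by simp_all
qed

lemma extreme_point_line_contradiction:
  assumes "v extreme_point_of P" "x + s *\<^sub>R d \<in> P" "x + u *\<^sub>R d \<in> P" "v = x + t *\<^sub>R d"
    "s < t" "t < u" "d \<noteq> 0"
  shows False
proof -
  have "v \<in> open_segment (x + s *\<^sub>R d) (x + u *\<^sub>R d)"
    unfolding assms(4) using assms(5-7) by (rule in_open_segment_line)
  then show False using assms(1-3) by (simp add: extreme_point_of_def)
qed


locale halfspace_system =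
  fixes I :: "'i set" and a :: "'i \<Rightarrow> 'a::euclidean_space" and c :: "'i \<Rightarrow> real"
  assumes finite_rows: "finite I"
begin

definition poly :: "'a set" where
  "poly = {x. \<forall>i\<in>I. c i \<le> a i \<bullet> x}"

definition tight_face :: "'i set \<Rightarrow> 'a set" where
  "tight_face S = {x \<in> poly. \<forall>i\<in>S. a i \<bullet> x = c i}"

lemma polyhedron_poly: "polyhedron poly"
proof -
  have "poly = (\<Inter>i\<in>I. {x. c i \<le> a i \<bullet> x})" by (auto simp: poly_def)
  moreover have "polyhedron (\<Inter>i\<in>I. {x. c i \<le> a i \<bullet> x})"
    by (rule polyhedron_Inter) (auto simp: finite_rows polyhedron_halfspace_ge)
  ultimately show ?thesis by simp
qed

lemma poly_perturb:
  assumes m: "m \<in> poly" and z: "\<And>i. i \<in> I \<Longrightarrow> a i \<bullet> m = c i \<Longrightarrow> a i \<bullet> z = 0"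
  shows "\<exists>e>0. \<forall>t. \<bar>t\<bar> \<le> e \<longrightarrow> m + t *\<^sub>R z \<in> poly"
proof -
  have "\<forall>\<^sub>F t in nhds 0. c i \<le> a i \<bullet> (m + t *\<^sub>R z)" if i: "i \<in> I" for i
  proof (cases "a i \<bullet> m = c i")
    case True
    then show ?thesis using z[OF i] by (simp add: inner_simps)
  next
    case False
    moreover have "c i \<le> a i \<bullet> m" using m i by (simp add: poly_def)
    ultimately have "c i < a i \<bullet> m" by simp
    moreover have "((\<lambda>t. a i \<bullet> (m + t *\<^sub>R z)) \<longlongrightarrow> a i \<bullet> (m + 0 *\<^sub>R z)) (nhds 0)"
      by (intro tendsto_intros filterlim_ident)
    ultimately have "\<forall>\<^sub>F t in nhds 0. c i < a i \<bullet> (m + t *\<^sub>R z)"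
      by (intro order_tendstoD(1)[of _ "a i \<bullet> m"]) simp_all
    then show ?thesis by (rule eventually_mono) simp
  qed
  then have "\<forall>\<^sub>F t in nhds (0::real). \<forall>i\<in>I. c i \<le> a i \<bullet> (m + t *\<^sub>R z)"
    using finite_rows by (simp add: eventually_ball_finite)
  then obtain d where "d > 0" and d: "\<And>t. dist t 0 < d \<Longrightarrow> \<forall>i\<in>I. c i \<le> a i \<bullet> (m + t *\<^sub>R z)"
    unfolding eventually_nhds_metric by blast
  have "m + t *\<^sub>R z \<in> poly" if "\<bar>t\<bar> \<le> d / 2" for t
    using d[of t] that \<open>d > 0\<close> by (auto simp: dist_real_def poly_def)
  then show ?thesis using \<open>d > 0\<close> by (intro exI[of _ "d / 2"]) simp
qed

lemma tight_face_mono: "S \<subseteq> S' \<Longrightarrow> tight_face S' \<subseteq> tight_face S"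
  by (auto simp: tight_face_def)

lemma face_of_tight_face:
  assumes "S \<subseteq> I"
  shows "tight_face S face_of poly"
proof -
  have *: "{x \<in> poly. a i \<bullet> x = c i} face_of poly" if "i \<in> S" for i
  proof -
    have "poly \<inter> {x. a i \<bullet> x = c i} face_of poly"
      using assms that polyhedron_imp_convex[OF polyhedron_poly]
      by (intro face_of_Int_supporting_hyperplane_ge) (auto simp: poly_def)
    then show ?thesis by (simp add: Collect_conj_eq)
  qed
  show ?thesis
  proof (cases "S = {}")
    case True
    then show ?thesis using face_of_refl[OF polyhedron_imp_convex[OF polyhedron_poly]]
      by (simp add: tight_face_def)
  next
    case False
    then have "tight_face S = (\<Inter>i\<in>S. {x \<in> poly. a i \<bullet> x = c i})" by (auto simp: tight_face_def)
    also have "\<dots> face_of poly" using False * by (intro face_of_Inter) auto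
    finally show ?thesis .
  qed
qed

lemma proper_face_extra_tight:
  assumes G: "G face_of poly" "G \<subseteq> tight_face S" "G \<noteq> tight_face S" "G \<noteq> {}" and S: "S \<subseteq> I"
  obtains j where "j \<in> I - S" "G \<subseteq> tight_face (insert j S)"
proof -
  have "convex G" using G(1) by (rule face_of_imp_convex)
  then have "rel_interior G \<noteq> {}" using G(4) by (simp add: rel_interior_eq_empty)
  then obtain x where x: "x \<in> rel_interior G" by blast
  then have xG: "x \<in> G" using rel_interior_subset by blast
  then have xS: "x \<in> tight_face S" using G(2) by blast
  obtain y where y: "y \<in> tight_face S" "y \<notin> G" using G(2,3) by blast
  have "\<exists>j\<in>I - S. a j \<bullet> x = c j"
  proof (rule ccontr)
    assume neg: "\<not> ?thesis"
    have xP: "x \<in> poly" using xS by (simp add: tight_face_def)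
    have rows: "a i \<bullet> (x - y) = 0" if "i \<in> I" "a i \<bullet> x = c i" for i
      using neg that y(1) by (auto simp: tight_face_def inner_simps)
    obtain e where e: "e > 0" "\<forall>t. \<bar>t\<bar> \<le> e \<longrightarrow> x + t *\<^sub>R (x - y) \<in> poly"
      using poly_perturb[OF xP rows] by auto
    then have "x + e *\<^sub>R (x - y) \<in> poly" by simp
    moreover have "x + (-1) *\<^sub>R (x - y) \<in> poly" using y(1) by (simp add: tight_face_def)
    moreover have "x + 0 *\<^sub>R (x - y) \<in> G" using xG by simp
    ultimately have "x + (-1) *\<^sub>R (x - y) \<in> G"
      by (intro face_of_line_extend(1)[OF G(1), of x "-1" "x - y" e 0]) (simp_all add: e(1))
    then show False using y(2) by simp
  qed
  then obtain j where j: "j \<in> I - S" "a j \<bullet> x = c j" by blast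
  have "tight_face (insert j S) face_of poly" using S j(1) by (intro face_of_tight_face) auto
  moreover have "G \<subseteq> poly" using G(1) by (rule face_of_imp_subset)
  moreover have "x \<in> tight_face (insert j S)" using xS j(2) by (auto simp: tight_face_def)
  then have "tight_face (insert j S) \<inter> rel_interior G \<noteq> {}" using x by blast
  ultimately have "G \<subseteq> tight_face (insert j S)" by (rule subset_of_face_of)
  with j(1) show ?thesis by (rule that)
qed

lemma card_tight_extreme_point:
  assumes "x extreme_point_of poly"
  shows "DIM('a) \<le> card {i \<in> I. a i \<bullet> x = c i}"
proof (rule ccontr)
  let ?B = "a ` {i \<in> I. a i \<bullet> x = c i}"
  assume "\<not> ?thesis"
  then have "dim (span ?B) < DIM('a)"
    using dim_le_card'[of ?B] card_image_le[of "{i \<in> I. a i \<bullet> x = c i}" a] finite_rows by simp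
  then obtain z where z: "z \<noteq> 0" "\<And>y. y \<in> span ?B \<Longrightarrow> orthogonal z y"
    using orthogonal_to_subspace_exists[of ?B] by (auto simp: dim_span)
  have xP: "x \<in> poly" using assms by (simp add: extreme_point_of_def)
  have rows: "a i \<bullet> z = 0" if "i \<in> I" "a i \<bullet> x = c i" for i
  proof -
    have "orthogonal z (a i)" using that by (intro z(2) span_base) auto
    then show ?thesis by (simp add: orthogonal_def inner_commute)
  qed
  obtain e where e: "e > 0" "\<forall>t. \<bar>t\<bar> \<le> e \<longrightarrow> x + t *\<^sub>R z \<in> poly"
    using poly_perturb[OF xP rows] by auto
  then have "x + e *\<^sub>R z \<in> poly" "x + (-e) *\<^sub>R z \<in> poly" using spec[OF e(2), of "-e"] by simp_all
  then show False
    using extreme_point_line_contradiction[OF assms, of x "-e" z e 0] e(1) z(1) by simp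
qed

lemma edge_direction_rows:
  assumes G: "G face_of poly" "aff_dim G \<le> 1" "x \<in> G" "y \<in> G" "x \<noteq> y"
    and z: "z \<noteq> 0" "\<And>i. i \<in> I \<Longrightarrow> a i \<bullet> (y - x) = 0 \<Longrightarrow> a i \<bullet> z = 0"
  shows "\<exists>k. k \<noteq> 0 \<and> z = k *\<^sub>R (y - x)"
proof -
  define m where "m = x + (1/2) *\<^sub>R (y - x)"
  have xy: "x \<in> poly" "y \<in> poly" using G face_of_imp_subset by blast+
  have mG: "m \<in> G"
    unfolding m_def using face_of_imp_convex[OF G(1)] G(3,4) by (rule convex_line) simp_all
  have mP: "m \<in> poly" using mG G(1) face_of_imp_subset by blast
  have am: "2 * (a i \<bullet> m) = a i \<bullet> x + a i \<bullet> y" for i by (simp add: m_def inner_simps field_simps)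
  have rows: "a i \<bullet> z = 0" if i: "i \<in> I" "a i \<bullet> m = c i" for i
  proof (rule z(2)[OF i(1)])
    have "c i \<le> a i \<bullet> x" "c i \<le> a i \<bullet> y" using xy i(1) by (auto simp: poly_def)
    then show "a i \<bullet> (y - x) = 0" using am[of i] i(2) by (simp add: inner_simps)
  qed
  obtain e where e: "e > 0" "\<forall>t. \<bar>t\<bar> \<le> e \<longrightarrow> m + t *\<^sub>R z \<in> poly"
    using poly_perturb[OF mP rows] by auto
  then have "m + e *\<^sub>R z \<in> poly" "m + (-e) *\<^sub>R z \<in> poly" using spec[OF e(2), of "-e"] by simp_all
  then have "m + e *\<^sub>R z \<in> G"
    using face_of_line_extend(2)[OF G(1), of m "-e" z e 0] mG e(1) by simp
  then obtain u where "m + e *\<^sub>R z = x + u *\<^sub>R (y - x)"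
    using mem_line_of_aff_dim_le_1[OF G(2-5)] by blast
  then have "e *\<^sub>R z = (u - 1/2) *\<^sub>R (y - x)" by (simp add: m_def algebra_simps)
  then have "(1 / e) *\<^sub>R (e *\<^sub>R z) = (1 / e) *\<^sub>R ((u - 1/2) *\<^sub>R (y - x))" by simp
  then have "z = ((u - 1/2) / e) *\<^sub>R (y - x)" using e(1) by simp
  moreover from this have "(u - 1/2) / e \<noteq> 0" using z(1) by auto
  ultimately show ?thesis by blast
qed

lemma aff_dim_tight_face_le:
  assumes lin: "linefree poly" and S: "S \<subseteq> I" and n: "n \<ge> -1"
    and step: "\<And>j. j \<in> I - S \<Longrightarrow> aff_dim (tight_face (insert j S)) \<le> n"
  shows "aff_dim (tight_face S) \<le> n + 1"
proof (cases "tight_face S = {}")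
  case True
  then show ?thesis using n by simp
next
  case False
  have face: "tight_face S face_of poly" using S by (rule face_of_tight_face)
  obtain G where G: "G face_of tight_face S" "G \<noteq> tight_face S" "aff_dim G = aff_dim (tight_face S) - 1"
    using codim_1_face_exists[OF face_of_polyhedron_polyhedron[OF polyhedron_poly face]
        linefree_subset[OF lin face_of_imp_subset[OF face]] False] by metis
  have "aff_dim G \<le> n"
  proof (cases "G = {}")
    case True
    then show ?thesis using n by simp
  next
    case False
    obtain j where j: "j \<in> I - S" "G \<subseteq> tight_face (insert j S)"
      using face_of_trans[OF G(1) face] face_of_imp_subset[OF G(1)] G(2) False S
      by (rule proper_face_extra_tight)
    show ?thesis using aff_dim_subset[OF j(2)] step[OF j(1)] by simp
  qed
  then show ?thesis using G(3) by simp
qed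

end

subsection \<open>Circuit walks\<close>

lemma extreme_ray_unbounded:
  fixes G :: "'a::euclidean_space set"
  assumes "convex G" "aff_dim G \<le> 1" "\<not> bounded G" "q extreme_point_of G"
  obtains r where "r \<noteq> 0" "\<And>s. s \<ge> 0 \<Longrightarrow> q + s *\<^sub>R r \<in> G"
proof -
  have q: "q \<in> G" using assms(4) by (simp add: extreme_point_of_def)
  have far: "\<exists>w\<in>G. dist q w > e" for e
  proof (rule ccontr)
    assume "\<not> ?thesis"
    then have "\<forall>w\<in>G. dist q w \<le> e" by (simp add: not_less)
    then have "bounded G" unfolding bounded_def by (intro exI)
    then show False using assms(3) by simp
  qed
  obtain y where y: "y \<in> G" "dist q y > 0" using far by blast
  define r where "r = y - q"
  have r0: "r \<noteq> 0" using y(2) by (simp add: r_def)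
  have yr: "q + 1 *\<^sub>R r \<in> G" using y(1) by (simp add: r_def)
  have "q + s *\<^sub>R r \<in> G" if s: "s \<ge> 0" for s
  proof -
    obtain w where w: "w \<in> G" "dist q w > s * norm r" using far by blast
    have "\<exists>u. w = q + u *\<^sub>R (y - q)"
      using assms(2) q y(1) _ w(1) by (rule mem_line_of_aff_dim_le_1) (use y(2) in simp)
    then obtain u where u: "w = q + u *\<^sub>R r" unfolding r_def by blast
    have "\<bar>u\<bar> * norm r > s * norm r" using w(2) by (simp add: u dist_norm)
    then have us: "\<bar>u\<bar> > s" by (simp add: r0)
    have "\<not> u < 0"
    proof
      assume "u < 0"
      then show False
        using extreme_point_line_contradiction[OF assms(4), of q u r 1 0] w(1) yr r0 by (simp add: u)
    qed
    then have u0: "s < u" "0 < u" using us s by auto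
    have "q + (s / u) *\<^sub>R (w - q) \<in> G"
      using assms(1) q w(1) by (rule convex_line) (use u0 s in simp_all)
    then show ?thesis using u0 by (simp add: u)
  qed
  then show ?thesis using r0 by (intro that)
qed

lemma line_exit:
  fixes S :: "'a::real_normed_vector set"
  assumes "closed S" "convex S" "x \<in> S" "0 \<le> t0" "x + t0 *\<^sub>R d \<notin> S"
  obtains t where "t \<ge> 0" "x + t *\<^sub>R d \<in> S" "\<And>s. s > t \<Longrightarrow> x + s *\<^sub>R d \<notin> S"
proof -
  let ?T = "{0..t0} \<inter> (\<lambda>t. x + t *\<^sub>R d) -` S"
  have "closed ((\<lambda>t. x + t *\<^sub>R d) -` S)"
    using assms(1) by (intro closed_vimage continuous_intros)
  then have "compact ?T" by (intro compact_Int_closed) auto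
  moreover have "0 \<in> ?T" using assms by simp
  ultimately obtain t where t: "t \<in> ?T" "\<And>s. s \<in> ?T \<Longrightarrow> s \<le> t"
    using compact_attains_sup[of ?T] by blast
  have "x + s *\<^sub>R d \<notin> S" if "s > t" for s
  proof
    assume sS: "x + s *\<^sub>R d \<in> S"
    then have "s > t0" using t(1) t(2)[of s] that by force
    then have s: "s > 0" "t0 / s \<le> 1" "0 \<le> t0 / s" using assms(4) by simp_all
    have "x + (t0 / s) *\<^sub>R ((x + s *\<^sub>R d) - x) \<in> S"
      using assms(2,3) sS s(3,2) by (rule convex_line)
    then show False using assms(5) s(1) by simp
  qed
  then show ?thesis using t(1) by (intro that[of t]) auto
qed

lemma coprime_integral_neq_0: "coprime_integral g \<Longrightarrow> g \<noteq> 0"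
proof
  assume "coprime_integral g" "g = 0"
  then obtain z :: "'a \<Rightarrow> int" where z: "\<forall>j. z j = 0" "Gcd (range z) = 1"
    unfolding coprime_integral_def by auto
  have "range z = {0}" using z(1) by auto
  then show False using z(2) by simp
qed

lemma coprime_integral_uminus:
  assumes "coprime_integral g"
  shows "coprime_integral (- g)"
proof -
  obtain z :: "'a \<Rightarrow> int" where z: "\<forall>j. g $ j = of_int (z j)" "Gcd (range z) = 1"
    using assms unfolding coprime_integral_def by auto
  have "Gcd (range (\<lambda>j. - z j)) = Gcd (range z)"
  proof (rule Gcd_eqI)
    fix c assume c: "\<And>b. b \<in> range (\<lambda>j. - z j) \<Longrightarrow> c dvd b"
    have "c dvd b" if "b \<in> range z" for b
    proof -
      have "c dvd - b" using that by (intro c) auto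
      then show ?thesis by simp
    qed
    then show "c dvd Gcd (range z)" by (rule Gcd_greatest)
  qed (auto intro: Gcd_dvd)
  then show ?thesis using z unfolding coprime_integral_def
    by (intro exI[of _ "\<lambda>j. - z j"]) simp
qed

lemma is_circuit_scaled:
  fixes A :: "real^'n^'m"
  assumes d: "d \<noteq> 0" and min: "\<And>x. x \<noteq> 0 \<Longrightarrow> \<not> support (A *v x) \<subset> support (A *v d)"
  obtains k where "k > 0" "is_circuit A (k *\<^sub>R d)"
proof -
  obtain k :: real where k: "k > 0" "(\<exists>c. coprime_integral (c *\<^sub>R d)) \<longrightarrow> coprime_integral (k *\<^sub>R d)"
  proof (cases "\<exists>c. coprime_integral (c *\<^sub>R d)")
    case True
    then obtain c where c: "coprime_integral (c *\<^sub>R d)" by blast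
    then have "c \<noteq> 0" using coprime_integral_neq_0[OF c] by auto
    moreover have "coprime_integral (\<bar>c\<bar> *\<^sub>R d)"
      using c coprime_integral_uminus[OF c] by (simp add: abs_real_def)
    ultimately show ?thesis by (intro that[of "\<bar>c\<bar>"]) simp_all
  next
    case False
    then show ?thesis by (intro that[of 1]) simp_all
  qed
  have "support (A *v (k *\<^sub>R d)) = support (A *v d)"
    using k(1) by (simp add: support_def scaleR_matrix_vector_assoc [symmetric] matrix_vector_mult_scaleR)
  then have "is_circuit A (k *\<^sub>R d)"
    unfolding is_circuit_def using d k min by auto
  then show ?thesis using k(1) by (intro that)
qed

locale inequality_system =
  fixes A :: "real^'n^'m" and b :: "real^'m"
begin

abbreviation P :: "(real^'n) set" where "P \<equiv> polyhedron_of A b"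

sublocale rows: halfspace_system UNIV "\<lambda>i. A $ i" "\<lambda>i. b $ i"
  rewrites "rows.poly = P"
proof -
  show "halfspace_system (UNIV :: 'm set)" by unfold_locales simp
  then interpret halfspace_system UNIV "\<lambda>i. A $ i" "\<lambda>i. b $ i" .
  show "halfspace_system.poly UNIV (\<lambda>i. A $ i) (\<lambda>i. b $ i) = P"
    by (simp add: poly_def polyhedron_of_def matrix_vector_mul_component)
qed

lemma closed_P: "closed P" and convex_P: "convex P"
  using rows.polyhedron_poly by (simp_all add: polyhedron_imp_closed polyhedron_imp_convex)

lemma recession_direction:
  assumes "\<And>s. s \<ge> 0 \<Longrightarrow> q + s *\<^sub>R r \<in> P" "x \<in> P" "t \<ge> 0"
  shows "x + t *\<^sub>R r \<in> P"
proof -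
  have "A $ i \<bullet> r \<ge> 0" for i
  proof (rule ccontr)
    assume neg: "\<not> A $ i \<bullet> r \<ge> 0"
    define s where "s = (\<bar>A $ i \<bullet> q - b $ i\<bar> + 1) / - (A $ i \<bullet> r)"
    have "s * (A $ i \<bullet> r) = - (\<bar>A $ i \<bullet> q - b $ i\<bar> + 1)" using neg by (simp add: s_def field_simps)
    moreover have "s \<ge> 0" unfolding s_def using neg by (intro divide_nonneg_nonneg) auto
    then have "b $ i \<le> A $ i \<bullet> (q + s *\<^sub>R r)"
      using assms(1) by (simp add: polyhedron_of_def matrix_vector_mul_component)
    ultimately show False by (simp add: inner_simps)
  qed
  then have "t * (A $ i \<bullet> r) \<ge> 0" for i using assms(3) by simp
  moreover have "b $ i \<le> A $ i \<bullet> x" for i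
    using assms(2) by (simp add: polyhedron_of_def matrix_vector_mul_component)
  ultimately have "b $ i + 0 \<le> A $ i \<bullet> x + t * (A $ i \<bullet> r)" for i
    by (rule add_mono[rotated])
  then show ?thesis by (simp add: polyhedron_of_def matrix_vector_mul_component inner_simps)
qed

lemma linefree_of_extreme_point:
  assumes "v extreme_point_of P"
  shows "linefree P"
proof (rule linefreeI, rule ccontr)
  fix x d assume line: "\<And>t::real. x + t *\<^sub>R d \<in> P" and d: "d \<noteq> 0"
  have v: "v \<in> P" using assms by (simp add: extreme_point_of_def)
  have "v + 1 *\<^sub>R d \<in> P" using line v by (rule recession_direction) simp
  moreover have "x + s *\<^sub>R (- d) \<in> P" for s :: real using line[of "- s"] by simp
  then have "v + 1 *\<^sub>R (- d) \<in> P" using v by (rule recession_direction) simp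
  then have "v + (-1) *\<^sub>R d \<in> P" by simp
  ultimately show False
    using extreme_point_line_contradiction[OF assms, of v "-1" d 1 0] d by simp
qed

lemma circuit_step_along_edge:
  assumes G: "G face_of P" "aff_dim G \<le> 1" "x \<in> G" "y \<in> G" "x \<noteq> y"
    and t: "t > 0" "\<And>s. s > t \<Longrightarrow> z + s *\<^sub>R (y - x) \<notin> P"
  shows "circuit_step A b z (z + t *\<^sub>R (y - x))"
proof -
  have minimal: "\<not> support (A *v d) \<subset> support (A *v (y - x))" if "d \<noteq> 0" for d
  proof
    assume *: "support (A *v d) \<subset> support (A *v (y - x))"
    have "\<exists>k. k \<noteq> 0 \<and> d = k *\<^sub>R (y - x)"
    proof (rule rows.edge_direction_rows[OF G that])
      fix i assume "A $ i \<bullet> (y - x) = 0"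
      then have "i \<notin> support (A *v (y - x))" by (simp add: support_def matrix_vector_mul_component)
      then have "i \<notin> support (A *v d)" using * by blast
      then show "A $ i \<bullet> d = 0" by (simp add: support_def matrix_vector_mul_component)
    qed
    then obtain k where "k \<noteq> 0" "d = k *\<^sub>R (y - x)" by blast
    then have "support (A *v d) = support (A *v (y - x))"
      by (simp add: support_def matrix_vector_mul_component)
    then show False using * by simp
  qed
  have "y - x \<noteq> 0" using G(5) by simp
  then obtain k where k: "k > 0" "is_circuit A (k *\<^sub>R (y - x))"
    using minimal by (rule is_circuit_scaled)
  have "z + s *\<^sub>R k *\<^sub>R (y - x) \<notin> P" if "s > t / k" for s
  proof -
    have "s * k > t" using that k(1) by (simp add: pos_divide_less_eq)
    then show ?thesis using t(2)[of "s * k"] by simp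
  qed
  then show ?thesis
    unfolding circuit_step_def using k t(1)
    by (intro exI[of _ "k *\<^sub>R (y - x)"] exI[of _ "t / k"]) simp
qed

lemma circuit_step_to_extreme_point:
  assumes "G face_of P" "aff_dim G \<le> 1" "x \<in> G" "v \<in> G" "x \<noteq> v" "v extreme_point_of P"
  shows "circuit_step A b x v"
proof -
  have xP: "x \<in> P" using assms(1,3) face_of_imp_subset by blast
  have "circuit_step A b x (x + 1 *\<^sub>R (v - x))"
  proof (rule circuit_step_along_edge[OF assms(1-5)])
    show "x + s *\<^sub>R (v - x) \<notin> P" if "s > 1" for s
    proof
      assume "x + s *\<^sub>R (v - x) \<in> P"
      then show False
        using extreme_point_line_contradiction[OF assms(6), of x 0 "v - x" s 1] that xP assms(5)
        by simp
    qed
  qed simp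
  then show ?thesis by simp
qed

lemma circuit_distance_le:
  "circuit_walk A b k y \<Longrightarrow> y 0 = u \<Longrightarrow> y k = v \<Longrightarrow> circuit_distance A b u v \<le> enat k"
  unfolding circuit_distance_def
  by (rule Inf_lower, rule CollectI, rule exI[of _ k], rule conjI[OF refl], rule exI[of _ y]) simp

lemma circuit_walk_of_distance:
  assumes "circuit_distance A b u v \<le> enat n"
  obtains k y where "k \<le> n" "circuit_walk A b k y" "y 0 = u" "y k = v"
proof -
  let ?S = "{enat k | k. \<exists>y. circuit_walk A b k y \<and> y 0 = u \<and> y k = v}"
  have "?S \<noteq> {}"
  proof
    assume "?S = {}"
    then have "circuit_distance A b u v = \<infinity>"
      unfolding circuit_distance_def by (simp only: Inf_empty top_enat_def)
    then show False using assms by simp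
  qed
  then obtain e where "e \<in> ?S" by blast
  then have "circuit_distance A b u v \<in> ?S"
    unfolding circuit_distance_def by (rule wellorder_InfI)
  then obtain k y where k: "circuit_distance A b u v = enat k"
    and y: "circuit_walk A b k y" "y 0 = u" "y k = v" by blast
  have "k \<le> n" using assms by (simp add: k)
  then show ?thesis using y by (rule that)
qed

lemma circuit_distance_refl: "u \<in> P \<Longrightarrow> circuit_distance A b u u \<le> enat 0"
  by (rule circuit_distance_le[of 0 "\<lambda>_. u"]) (simp_all add: circuit_walk_def)

lemma circuit_distance_step:
  assumes "circuit_distance A b u v \<le> enat n" "circuit_step A b v w" "w \<in> P"
  shows "circuit_distance A b u w \<le> enat (Suc n)"
proof -
  obtain k y where k: "k \<le> n" and y: "circuit_walk A b k y" "y 0 = u" "y k = v"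
    using assms(1) by (rule circuit_walk_of_distance)
  have "circuit_walk A b (Suc k) (y(Suc k := w))"
    unfolding circuit_walk_def
  proof (intro conjI allI impI)
    show "(y(Suc k := w)) i \<in> P" if "i \<le> Suc k" for i
      using y(1) assms(3) that by (simp add: circuit_walk_def)
    show "circuit_step A b ((y(Suc k := w)) i) ((y(Suc k := w)) (Suc i))" if "i < Suc k" for i
      using y(1,3) assms(2) that by (cases "i = k") (simp_all add: circuit_walk_def)
  qed
  then have "circuit_distance A b u w \<le> enat (Suc k)"
    by (rule circuit_distance_le) (simp_all add: y(2))
  also have "\<dots> \<le> enat (Suc n)" using k by simp
  finally show ?thesis .
qed

end

subsection \<open>A shortcut in an unbounded two-dimensional face\<close>

lemma slope_argument:
  fixes \<alpha> \<beta> x y eu ew au aw :: real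
  assumes "\<alpha> > 0" "\<beta> > 0" "y > 0" "au < 0"
    and er: "\<alpha> * eu + \<beta> * ew = 0" and eq: "x * eu + y * ew < 0"
    and aq: "(x - 1) * au + y * aw = 0" and ar: "\<alpha> * au + \<beta> * aw \<ge> 0"
  shows "ew > 0"
proof (rule ccontr)
  assume "\<not> ew > 0"
  then have ew: "ew \<le> 0" by simp
  have "y * (\<alpha> * au + \<beta> * aw) \<ge> 0" using assms(3) ar by simp
  also have "y * (\<alpha> * au + \<beta> * aw) = au * (y * \<alpha> - (x - 1) * \<beta>) + \<beta> * ((x - 1) * au + y * aw)"
    by (simp add: algebra_simps)
  finally have "au * (y * \<alpha> - (x - 1) * \<beta>) \<ge> 0" by (simp add: aq)
  then have "y * \<alpha> - (x - 1) * \<beta> \<le> 0" using assms(4) by (simp add: zero_le_mult_iff)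
  then have "y * \<alpha> - x * \<beta> \<le> 0" using assms(2) by (simp add: algebra_simps)
  then have "ew * (y * \<alpha> - x * \<beta>) \<ge> 0" using ew by (simp add: mult_nonpos_nonpos)
  also have "ew * (y * \<alpha> - x * \<beta>) = \<alpha> * (x * eu + y * ew) - x * (\<alpha> * eu + \<beta> * ew)"
    by (simp add: algebra_simps)
  finally have "\<alpha> * (x * eu + y * ew) \<ge> 0" by (simp add: er)
  then show False using eq assms(1) by (simp add: zero_le_mult_iff)
qed

context inequality_system
begin

text \<open>
  The boundary of the two-dimensional face \<open>F\<close> is a chain \<open>rm, em, e0, e1, e2, rp\<close> of edges,
  the first and the last being rays, with successive vertices \<open>q, p0, p1, p2, p3\<close>. The total
  turning angle of the chain is at most \<open>\<pi>\<close>, so the direction of \<open>e1\<close> leads from \<open>p0\<close> into \<open>F\<close>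
  and the step can only end on \<open>e2\<close> or \<open>rp\<close>. Angles are compared in the coordinates with
  origin \<open>p1\<close> and basis \<open>p0 - p1\<close>, \<open>p2 - p1\<close>.
\<close>

lemma unbounded_face_shortcut:
  assumes F: "F face_of P" "aff_dim F \<le> 2"
    and faces: "em face_of P" "e0 face_of P" "e1 face_of P" "e2 face_of P" "rm face_of P" "rp face_of P"
    and sub: "em \<subseteq> F" "e1 \<subseteq> F" "rm \<subseteq> F"
    and dim: "aff_dim e1 \<le> 1" "aff_dim e2 \<le> 1" "aff_dim rm \<le> 1" "aff_dim rp \<le> 1"
    and cover: "\<And>G. G face_of P \<Longrightarrow> G \<subseteq> F \<Longrightarrow> G \<noteq> F \<Longrightarrow> G \<noteq> {} \<Longrightarrow>
      G \<subseteq> em \<or> G \<subseteq> e0 \<or> G \<subseteq> e1 \<or> G \<subseteq> e2 \<or> G \<subseteq> rm \<or> G \<subseteq> rp"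
    and mem: "q \<in> rm" "q \<in> em" "p0 \<in> em" "p0 \<in> e0" "p1 \<in> e0" "p1 \<in> e1" "p2 \<in> e1" "p2 \<in> e2"
      "p3 \<in> e2" "p3 \<in> rp"
    and nonmem: "q \<notin> e0" "p1 \<notin> em" "p1 \<notin> rm" "p2 \<notin> e0" "p0 \<notin> e1"
    and ext: "q extreme_point_of P" "p0 extreme_point_of P" "p2 extreme_point_of P" "p3 extreme_point_of P"
    and unbounded: "\<not> bounded rm"
    and start: "circuit_distance A b v p0 \<le> enat n"
  shows "circuit_distance A b v p3 \<le> enat (n + 2)"
proof -
  note FP = face_of_imp_subset[OF F(1)]
  have inF: "q \<in> F" "p0 \<in> F" "p1 \<in> F" "p2 \<in> F" using mem sub by blast+
  then have inP: "q \<in> P" "p0 \<in> P" "p1 \<in> P" "p2 \<in> P" using FP by blast+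
  have p3P: "p3 \<in> P" using ext(4) by (simp add: extreme_point_of_def)
  define u where "u = p0 - p1"
  define w where "w = p2 - p1"
  have u0: "u \<noteq> 0" using mem nonmem by (auto simp: u_def)
  have w0: "w \<noteq> 0" using mem nonmem by (auto simp: w_def)
  have p0_eq: "p0 = p1 + u" and p2_eq: "p2 = p1 + w" by (simp_all add: u_def w_def)
  obtain f bf where f: "\<And>x. x \<in> P \<Longrightarrow> bf \<le> f \<bullet> x" "\<And>x. x \<in> P \<Longrightarrow> x \<in> F \<longleftrightarrow> f \<bullet> x = bf"
    using polyhedron_face_functional[OF rows.polyhedron_poly F(1)] by metis
  obtain a ba where a: "\<And>x. x \<in> P \<Longrightarrow> ba \<le> a \<bullet> x" "\<And>x. x \<in> P \<Longrightarrow> x \<in> em \<longleftrightarrow> a \<bullet> x = ba"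
    using polyhedron_face_functional[OF rows.polyhedron_poly faces(1)] by metis
  obtain c bc where c: "\<And>x. x \<in> P \<Longrightarrow> bc \<le> c \<bullet> x" "\<And>x. x \<in> P \<Longrightarrow> x \<in> e0 \<longleftrightarrow> c \<bullet> x = bc"
    using polyhedron_face_functional[OF rows.polyhedron_poly faces(2)] by metis
  obtain d bd where d: "\<And>x. x \<in> P \<Longrightarrow> bd \<le> d \<bullet> x" "\<And>x. x \<in> P \<Longrightarrow> x \<in> e1 \<longleftrightarrow> d \<bullet> x = bd"
    using polyhedron_face_functional[OF rows.polyhedron_poly faces(3)] by metis
  obtain e be where e: "\<And>x. x \<in> P \<Longrightarrow> be \<le> e \<bullet> x" "\<And>x. x \<in> P \<Longrightarrow> x \<in> rm \<longleftrightarrow> e \<bullet> x = be"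
    using polyhedron_face_functional[OF rows.polyhedron_poly faces(5)] by metis
  have fu: "f \<bullet> u = 0" and fw: "f \<bullet> w = 0"
    using inF f(2)[OF inP(2)] f(2)[OF inP(3)] f(2)[OF inP(4)] by (simp_all add: u_def w_def inner_simps)
  have cu: "c \<bullet> u = 0" and cw: "c \<bullet> w > 0"
    using mem(4,5) nonmem(4) c(2)[OF inP(2)] c(2)[OF inP(3)] c(2)[OF inP(4)] c(1)[OF inP(4)]
    by (simp_all add: u_def w_def inner_simps)
  have dw: "d \<bullet> w = 0" and du: "d \<bullet> u > 0"
    using mem(6,7) nonmem(5) d(2)[OF inP(2)] d(2)[OF inP(3)] d(2)[OF inP(4)] d(1)[OF inP(2)]
    by (simp_all add: u_def w_def inner_simps)

  have "q extreme_point_of rm"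
    using ext(1) mem(1) extreme_point_of_face[OF faces(5)] by blast
  then obtain r where r0: "r \<noteq> 0" and r: "\<And>s. s \<ge> 0 \<Longrightarrow> q + s *\<^sub>R r \<in> rm"
    using extreme_ray_unbounded[OF face_of_imp_convex[OF faces(5)] dim(3) unbounded] by metis
  have rP: "q + s *\<^sub>R r \<in> P" if "s \<ge> 0" for s
    using r[OF that] sub(3) FP by blast
  have rec: "x + t *\<^sub>R r \<in> P" if "x \<in> P" "t \<ge> 0" for x t
    using rP that by (rule recession_direction)
  have qr: "q + r \<in> rm" "q + r \<in> P" using r[of 1] rP[of 1] by simp_all
  have er: "e \<bullet> r = 0"
    using e(2)[OF inP(1)] e(2)[OF qr(2)] mem(1) qr(1) by (simp add: inner_simps)
  have "q + r \<in> F" using qr(1) sub(3) by blast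
  then have fr: "f \<bullet> r = 0"
    using f(2)[OF inP(1)] f(2)[OF qr(2)] inF(1) by (simp add: inner_simps)
  have p1r: "p1 + r \<in> P" using rec[OF inP(3), of 1] by simp
  have "p1 + r \<in> F" using f(2)[OF p1r] f(2)[OF inP(3)] inF(3) fr by (simp add: inner_simps)
  moreover have plane: "\<exists>\<alpha> \<beta>. y = p1 + \<alpha> *\<^sub>R u + \<beta> *\<^sub>R w" if "y \<in> F" for y
    unfolding u_def w_def
    using F(2) inF(3,2,4) that
  proof (rule mem_plane_of_aff_dim_le_2)
    show "p1 \<noteq> p0" using u0 by (simp add: u_def)
    show "c \<bullet> p1 = c \<bullet> p0" "c \<bullet> p1 \<noteq> c \<bullet> p2" using cu cw by (simp_all add: u_def w_def inner_simps)
  qed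
  ultimately obtain \<alpha> \<beta> where "p1 + r = p1 + \<alpha> *\<^sub>R u + \<beta> *\<^sub>R w" by blast
  then have r_eq: "r = \<alpha> *\<^sub>R u + \<beta> *\<^sub>R w" by (simp add: add.assoc)
  have "\<beta> * (c \<bullet> w) \<ge> 0"
    using c(1)[OF p1r] c(2)[OF inP(3)] mem(5) cu by (simp add: r_eq inner_simps)
  then have \<beta>0: "\<beta> \<ge> 0" using cw by (simp add: zero_le_mult_iff)
  have "\<alpha> * (d \<bullet> u) \<ge> 0"
    using d(1)[OF p1r] d(2)[OF inP(3)] mem(6) dw by (simp add: r_eq inner_simps)
  then have \<alpha>0: "\<alpha> \<ge> 0" using du by (simp add: zero_le_mult_iff)
  have "\<alpha> \<noteq> 0"
  proof
    assume z: "\<alpha> = 0"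
    then have "\<beta> > 0" using \<beta>0 r0 r_eq by (cases "\<beta> = 0") simp_all
    moreover have "p1 + (1 + \<beta>) *\<^sub>R w \<in> P"
      using rec[OF inP(4), of 1] by (simp add: r_eq z p2_eq scaleR_add_left add.assoc)
    ultimately show False
      using extreme_point_line_contradiction[OF ext(3), of p1 0 w "1 + \<beta>" 1] inP(3) w0
      by (simp add: p2_eq)
  qed
  then have \<alpha>: "\<alpha> > 0" using \<alpha>0 by simp
  have "\<beta> \<noteq> 0"
  proof
    assume z: "\<beta> = 0"
    have "p1 + (1 + \<alpha>) *\<^sub>R u \<in> P"
      using rec[OF inP(2), of 1] by (simp add: r_eq z p0_eq scaleR_add_left add.assoc)
    then show False
      using extreme_point_line_contradiction[OF ext(2), of p1 0 u "1 + \<alpha>" 1] inP(3) u0 \<alpha>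
      by (simp add: p0_eq)
  qed
  then have \<beta>: "\<beta> > 0" using \<beta>0 by simp

  have feasible: "p0 + (\<beta> / \<alpha>) *\<^sub>R w \<in> P"
  proof -
    have "p1 + (1 / \<alpha>) *\<^sub>R r \<in> P" using rec[OF inP(3)] \<alpha> by simp
    moreover have "(1 / \<alpha>) *\<^sub>R r = u + (\<beta> / \<alpha>) *\<^sub>R w" using \<alpha> by (simp add: r_eq scaleR_add_right)
    ultimately show ?thesis by (simp add: p0_eq add.assoc)
  qed
  have "\<exists>t\<ge>0. p0 + t *\<^sub>R w \<notin> P"
  proof (rule ccontr)
    assume "\<not> ?thesis"
    then have all: "p0 + s *\<^sub>R w \<in> P" if "s \<ge> 0" for s using that by blast
    have "p1 + 2 *\<^sub>R w \<in> P" using recession_direction[OF all inP(3), of 2] by simp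
    then show False
      using extreme_point_line_contradiction[OF ext(3), of p1 0 w 2 1] inP(3) w0
      by (simp add: p2_eq)
  qed
  then obtain t0 where "t0 \<ge> 0" "p0 + t0 *\<^sub>R w \<notin> P" by blast
  then obtain t where t: "t \<ge> 0" "p0 + t *\<^sub>R w \<in> P" and exit: "\<And>s. s > t \<Longrightarrow> p0 + s *\<^sub>R w \<notin> P"
    using line_exit[OF closed_P convex_P inP(2)] by metis
  have "\<not> \<beta> / \<alpha> > t" using exit feasible by blast
  then have t_pos: "t > 0" using \<alpha> \<beta> by (smt (verit) divide_pos_pos)
  define x where "x = p0 + t *\<^sub>R w"
  have xP: "x \<in> P" using t(2) by (simp add: x_def)
  have xF: "x \<in> F" using f(2)[OF xP] f(2)[OF inP(2)] inF(2) fw by (simp add: x_def inner_simps)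

  have au: "a \<bullet> u < 0"
    using mem(3) nonmem(2) a(2)[OF inP(2)] a(2)[OF inP(3)] a(1)[OF inP(3)]
    by (simp add: u_def inner_simps)
  have ar: "\<alpha> * (a \<bullet> u) + \<beta> * (a \<bullet> w) \<ge> 0"
    using a(1)[OF rec[OF inP(2), of 1]] a(2)[OF inP(2)] mem(3) by (simp add: r_eq inner_simps)
  have aw: "a \<bullet> w > 0"
  proof -
    have "\<alpha> * (a \<bullet> u) < 0" using \<alpha> au by (simp add: mult_pos_neg)
    then have "\<beta> * (a \<bullet> w) > 0" using ar by linarith
    then show ?thesis using \<beta> by (simp add: zero_less_mult_iff)
  qed
  obtain x' y' where q_eq: "q = p1 + x' *\<^sub>R u + y' *\<^sub>R w" using plane[OF inF(1)] by blast
  have "c \<bullet> q > bc" using c[OF inP(1)] nonmem(1) by simp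
  then have "y' * (c \<bullet> w) > 0"
    using c(2)[OF inP(3)] mem(5) cu by (simp add: q_eq inner_simps)
  then have y': "y' > 0" using cw by (simp add: zero_less_mult_iff)
  have ew: "e \<bullet> w > 0"
    using \<alpha> \<beta> y' au
  proof (rule slope_argument)
    show "\<alpha> * (e \<bullet> u) + \<beta> * (e \<bullet> w) = 0" using er by (simp add: r_eq inner_simps)
    show "x' * (e \<bullet> u) + y' * (e \<bullet> w) < 0"
      using e(2)[OF inP(1)] mem(1) e[OF inP(3)] nonmem(3) by (simp add: q_eq inner_simps)
    show "(x' - 1) * (a \<bullet> u) + y' * (a \<bullet> w) = 0"
      using a(2)[OF inP(1)] mem(2,3) a(2)[OF inP(2)]
      by (simp add: q_eq p0_eq inner_simps algebra_simps)
  qed (rule ar)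

  have not_em: "x \<notin> em"
    using a(2)[OF xP] a(1)[OF inP(2)] mult_pos_pos[OF t_pos aw] by (simp add: x_def inner_simps)
  have not_e0: "x \<notin> e0"
    using c(2)[OF xP] c(1)[OF inP(2)] mult_pos_pos[OF t_pos cw] by (simp add: x_def inner_simps)
  have not_rm: "x \<notin> rm"
    using e(2)[OF xP] e(1)[OF inP(2)] mult_pos_pos[OF t_pos ew] by (simp add: x_def inner_simps)
  have not_e1: "x \<notin> e1"
    using d(2)[OF xP] d(2)[OF inP(2)] nonmem(5) dw by (simp add: x_def inner_simps)

  have "x \<notin> rel_interior F"
  proof
    assume "x \<in> rel_interior F"
    then obtain m where m: "m > 1" "\<forall>k. k > 1 \<and> k \<le> m \<longrightarrow> (1 - k) *\<^sub>R p0 + k *\<^sub>R x \<in> F"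
      using convex_rel_interior_if[OF face_of_imp_convex[OF F(1)]] hull_inc[OF inF(2)] by metis
    have "(1 - m) *\<^sub>R p0 + m *\<^sub>R x = p0 + (m * t) *\<^sub>R w" by (simp add: x_def algebra_simps)
    then have "p0 + (m * t) *\<^sub>R w \<in> P" using m FP by auto
    moreover have "m * t > t" using m(1) t_pos by simp
    ultimately show False using exit by blast
  qed
  then have "x \<in> rel_frontier F"
    using xF closure_subset unfolding rel_frontier_def by blast
  then obtain G where G: "G face_of F" "G \<noteq> F" "x \<in> G"
    using rel_frontier_of_polyhedron_alt[OF face_of_polyhedron_polyhedron[OF rows.polyhedron_poly F(1)]]
    by blast
  have "G \<subseteq> em \<or> G \<subseteq> e0 \<or> G \<subseteq> e1 \<or> G \<subseteq> e2 \<or> G \<subseteq> rm \<or> G \<subseteq> rp"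
    using face_of_trans[OF G(1) F(1)] face_of_imp_subset[OF G(1)] G(2) by (rule cover) (use G(3) in blast)
  then have x_end: "x \<in> e2 \<or> x \<in> rp"
    using G(3) not_em not_e0 not_e1 not_rm by blast

  have "circuit_step A b p0 (p0 + t *\<^sub>R (p2 - p1))"
    using faces(3) dim(1) mem(6,7) _ t_pos
    by (rule circuit_step_along_edge) (use w0 exit in \<open>simp_all add: w_def\<close>)
  then have "circuit_step A b p0 x" by (simp add: x_def w_def)
  then have dist_x: "circuit_distance A b v x \<le> enat (n + 1)"
    using circuit_distance_step[OF start] xP by simp
  show ?thesis
  proof (cases "x = p3")
    case True
    have "enat (n + 1) \<le> enat (n + 2)" by simp
    with dist_x show ?thesis unfolding True by (rule order_trans)
  next
    case False
    then have "circuit_step A b x p3"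
      using x_end circuit_step_to_extreme_point[OF faces(4) dim(2) _ mem(9) _ ext(4)]
        circuit_step_to_extreme_point[OF faces(6) dim(4) _ mem(10) _ ext(4)] by blast
    then show ?thesis using circuit_distance_step[OF dist_x] p3P by simp
  qed
qed

end

subsection \<open>The Klee-Walkup polyhedron\<close>

text \<open>The rows are numbered \<open>1, \<dots>, 8\<close>; in the type \<open>8\<close> the last one is \<open>of_nat 8 = 0\<close>.\<close>

definition kw_row :: "nat \<Rightarrow> real^4" where "kw_row i = KW_A $ of_nat i"

definition kw_rhs :: "nat \<Rightarrow> real" where "kw_rhs i = KW_b $ of_nat i"

text \<open>A vertex is labelled by the list of its tight rows.\<close>

definition kw_vertices :: "nat list list" where
  "kw_vertices =
    [[1, 2, 3, 4],
     [1, 3, 4, 5],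
     [1, 4, 5, 8],
     [1, 4, 6, 7],
     [1, 4, 7, 8],
     [1, 6, 7, 8],
     [2, 3, 4, 6],
     [2, 3, 5, 8],
     [2, 3, 6, 7],
     [2, 3, 7, 8],
     [2, 5, 7, 8],
     [3, 4, 5, 8],
     [3, 4, 6, 7],
     [3, 4, 7, 8],
     [5, 6, 7, 8]]"

definition kw_table :: "(nat list \<times> (real^4)) list" where
  "kw_table = zip kw_vertices
    [vector [1, 1, 8, 8],
     vector [0, 1/2, 13/6, 1/2],
     vector [0, 1/3, 11/9, 0],
     vector [2/9, 0, 0, 1/3],
     vector [11/75, 1/25, 0, 0],
     vector [1/6, 0, 0, 0],
     vector [1/2, 0, 1/2, 13/6],
     vector [0, 2/9, 1/3, 0],
     vector [1/3, 0, 0, 11/9],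
     vector [1/25, 11/75, 0, 0],
     vector [0, 1/6, 0, 0],
     vector [0, 8/25, 16/15, 0],
     vector [8/25, 0, 0, 16/15],
     vector [1/10, 1/10, 0, 0],
     vector [0, 0, 0, 0]]"

definition kw_point :: "nat list \<Rightarrow> real^4" where
  "kw_point T = the (map_of kw_table T)"

lemma kw_point_in_table:
  assumes "T \<in> set kw_vertices"
  shows "(T, kw_point T) \<in> set kw_table"
proof -
  have "map fst kw_table = kw_vertices"
    unfolding kw_table_def by (rule map_fst_zip) (simp add: kw_vertices_def)
  then have "fst ` set kw_table = set kw_vertices" by (metis set_map)
  then have "map_of kw_table T \<noteq> None" using assms by (simp add: map_of_eq_None_iff)
  then obtain y where "map_of kw_table T = Some y" by blast
  then show ?thesis by (simp add: kw_point_def map_of_SomeD)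
qed

lemma kw_row_inner:
  "kw_row 1 \<bullet> x = - 6 * x$1 - 3 * x$2 + x$4"
  "kw_row (Suc 0) \<bullet> x = - 6 * x$1 - 3 * x$2 + x$4"
  "kw_row 2 \<bullet> x = - 3 * x$1 - 6 * x$2 + x$3"
  "kw_row 3 \<bullet> x = - 35 * x$1 - 45 * x$2 + 6 * x$3 + 3 * x$4"
  "kw_row 4 \<bullet> x = - 45 * x$1 - 35 * x$2 + 3 * x$3 + 6 * x$4"
  "kw_row 5 \<bullet> x = x$1" "kw_row 6 \<bullet> x = x$2" "kw_row 7 \<bullet> x = x$3" "kw_row 8 \<bullet> x = x$4"
  by (simp_all add: kw_row_def KW_A_def vector_def inner_vec_def sum_4)

lemma kw_rhs_simps:
  "kw_rhs 1 = -1" "kw_rhs (Suc 0) = -1" "kw_rhs 2 = -1" "kw_rhs 3 = -8" "kw_rhs 4 = -8"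
  "kw_rhs 5 = 0" "kw_rhs 6 = 0" "kw_rhs 7 = 0" "kw_rhs 8 = 0"
  by (simp_all add: kw_rhs_def KW_b_def vector_def)

definition kw_index :: "nat set" where "kw_index = {1, 2, 3, 4, 5, 6, 7, 8}"

interpretation KW: halfspace_system kw_index kw_row kw_rhs
  rewrites "KW.poly = U4"
proof -
  show "halfspace_system kw_index" by unfold_locales (simp add: kw_index_def)
  then interpret halfspace_system kw_index kw_row kw_rhs .
  show "halfspace_system.poly kw_index kw_row kw_rhs = U4"
    unfolding poly_def
    by (rule set_eqI) (simp add: mem_U4_iff kw_index_def kw_row_inner kw_rhs_simps)
qed

abbreviation kw_face :: "nat set \<Rightarrow> (real^4) set" where "kw_face \<equiv> KW.tight_face"

lemma kw_vertices_wf: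
  "\<forall>T\<in>set kw_vertices. distinct T \<and> length T = 4 \<and> set T \<subseteq> kw_index"
  by (simp add: kw_vertices_def kw_index_def)

lemma kw_quadruples:
  "filter (\<lambda>T. length T = 4 \<and> T \<notin> set kw_vertices) (subseqs [1..<9]) =
    [[1,2,3,5], [1,2,3,6], [1,2,3,7], [1,2,3,8], [1,2,4,5], [1,2,4,6], [1,2,4,7],
     [1,2,4,8], [1,2,5,6], [1,2,5,7], [1,2,5,8], [1,2,6,7], [1,2,6,8], [1,2,7,8],
     [1,3,4,6], [1,3,4,7], [1,3,4,8], [1,3,5,6], [1,3,5,7], [1,3,5,8], [1,3,6,7],
     [1,3,6,8], [1,3,7,8], [1,4,5,6], [1,4,5,7], [1,4,6,8], [1,5,6,7], [1,5,6,8],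
     [1,5,7,8], [2,3,4,5], [2,3,4,7], [2,3,4,8], [2,3,5,6], [2,3,5,7], [2,3,6,8],
     [2,4,5,6], [2,4,5,7], [2,4,5,8], [2,4,6,7], [2,4,6,8], [2,4,7,8], [2,5,6,7],
     [2,5,6,8], [2,6,7,8], [3,4,5,6], [3,4,5,7], [3,4,6,8], [3,5,6,7], [3,5,6,8],
     [3,5,7,8], [3,6,7,8], [4,5,6,7], [4,5,6,8], [4,5,7,8], [4,6,7,8]]"
  by code_simp

lemma kw_face_4_list:
  assumes x: "x \<in> kw_face (set T)" and T: "T \<in> set (subseqs [1..<9])" "length T = 4"
  shows "T \<in> set kw_vertices \<and> x = kw_point T"
proof -
  have "x \<in> U4" and tight: "\<forall>i\<in>set T. kw_row i \<bullet> x = kw_rhs i"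
    using x by (auto simp: KW.tight_face_def)
  from this(1) have ineqs: "- 6 * x$1 - 3 * x$2 + x$4 \<ge> -1" "- 3 * x$1 - 6 * x$2 + x$3 \<ge> -1"
    "- 35 * x$1 - 45 * x$2 + 6 * x$3 + 3 * x$4 \<ge> -8" "- 45 * x$1 - 35 * x$2 + 3 * x$3 + 6 * x$4 \<ge> -8"
    "x$1 \<ge> 0" "x$2 \<ge> 0" "x$3 \<ge> 0" "x$4 \<ge> 0"
    by (simp_all add: mem_U4_iff)
  have "T \<in> set kw_vertices"
  proof (rule ccontr)
    assume "T \<notin> set kw_vertices"
    then have "T \<in> set (filter (\<lambda>T. length T = 4 \<and> T \<notin> set kw_vertices) (subseqs [1..<9]))"
      using T by simp
    with tight show False
      unfolding kw_quadruples set_simps insert_iff empty_iff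
      apply (elim disjE FalseE)
      apply (simp_all only: set_simps ball_simps kw_row_inner kw_rhs_simps)
      apply (elim conjE, insert ineqs, linarith)+
      done
  qed
  moreover from this have "(T, kw_point T) \<in> set kw_table" by (rule kw_point_in_table)
  then have "x$1 = kw_point T $ 1 \<and> x$2 = kw_point T $ 2 \<and> x$3 = kw_point T $ 3 \<and> x$4 = kw_point T $ 4"
    using tight
    unfolding kw_table_def kw_vertices_def zip_Cons_Cons zip_Nil set_simps insert_iff empty_iff prod.inject
    apply (elim disjE conjE FalseE)
    apply (simp_all only: set_simps ball_simps kw_row_inner kw_rhs_simps)
    apply (simp_all add: vector_def)
    done
  then have "x = kw_point T" by (simp add: vec_eq_iff forall_4)
  ultimately show ?thesis by simp
qed

lemma kw_point_tight:
  assumes "T \<in> set kw_vertices"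
  shows "kw_point T \<in> U4 \<and> (\<forall>i\<in>kw_index. kw_row i \<bullet> kw_point T = kw_rhs i \<longleftrightarrow> i \<in> set T)"
  using kw_point_in_table[OF assms(1)]
  unfolding kw_table_def kw_vertices_def zip_Cons_Cons zip_Nil set_simps insert_iff empty_iff prod.inject
  apply (elim disjE conjE FalseE)
  apply (simp_all only: kw_index_def ball_simps kw_row_inner kw_rhs_simps mem_U4_iff)
  apply (simp add: vector_def)+
  done
lemma kw_point_mem_iff:
  assumes "T \<in> set kw_vertices" "S \<subseteq> kw_index"
  shows "kw_point T \<in> kw_face S \<longleftrightarrow> S \<subseteq> set T"
proof -
  note * = kw_point_tight[OF assms(1)]
  have mem: "kw_point T \<in> U4" using * by (rule conjunct1)
  have tight: "kw_row i \<bullet> kw_point T = kw_rhs i \<longleftrightarrow> i \<in> set T" if "i \<in> kw_index" for i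
    using * that by blast
  have "(\<forall>i\<in>S. kw_row i \<bullet> kw_point T = kw_rhs i) \<longleftrightarrow> (\<forall>i\<in>S. i \<in> set T)"
    by (rule ball_cong[OF refl], rule tight, rule subsetD[OF assms(2)])
  then show ?thesis using mem unfolding KW.tight_face_def subset_eq by simp
qed
lemma kw_vertices_sorted: "\<forall>T\<in>set kw_vertices. sorted T"
  by (simp add: kw_vertices_def)

lemma kw_face_4:
  assumes "x \<in> kw_face S" "S \<subseteq> kw_index" "card S = 4"
  obtains T where "T \<in> set kw_vertices" "set T = S" "x = kw_point T"
proof -
  have "kw_index = set [1..<9]" unfolding kw_index_def by code_simp
  then have "S \<in> set ` set (subseqs [1..<9])" using assms(2) by (simp only: subseqs_powset Pow_iff)
  then obtain T where T: "T \<in> set (subseqs [1..<9])" "set T = S" by blast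
  have "distinct T" using T(1) by (rule subseqs_distinctD) simp
  then have "length T = 4" using assms(3) distinct_card[of T] T(2) by simp
  with kw_face_4_list[of x T] assms(1) T have "T \<in> set kw_vertices" "x = kw_point T" by simp_all
  then show ?thesis using T(2) by (intro that)
qed

lemma kw_face_vertex:
  assumes T: "T \<in> set kw_vertices"
  shows "kw_face (set T) = {kw_point T}"
proof -
  have wf: "distinct T" "length T = 4" "set T \<subseteq> kw_index" using bspec[OF kw_vertices_wf T] by simp_all
  have mem: "kw_point T \<in> kw_face (set T)" using kw_point_mem_iff[OF T wf(3)] by simp
  have "x = kw_point T" if x: "x \<in> kw_face (set T)" for x
  proof -
    have "card (set T) = 4" using distinct_card[OF wf(1)] wf(2) by simp
    then obtain T' where T': "T' \<in> set kw_vertices" "set T' = set T" "x = kw_point T'"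
      using kw_face_4[OF x wf(3)] by metis
    have "T' = T"
      using T'(2) T T'(1) kw_vertices_sorted kw_vertices_wf by (intro sorted_distinct_set_unique) simp_all
    then show ?thesis using T'(3) by simp
  qed
  with mem show ?thesis by blast
qed

lemma linefree_U4: "linefree U4"
proof (rule linefreeI)
  fix x d :: "real^4" assume *: "\<And>t::real. x + t *\<^sub>R d \<in> U4"
  have zero: "d $ i = 0" if nonneg: "\<And>y. y \<in> U4 \<Longrightarrow> y $ i \<ge> 0" for i
  proof (rule ccontr)
    assume d: "d $ i \<noteq> 0"
    have "(x + (- (x $ i + 1) / d $ i) *\<^sub>R d) $ i = -1" using d by simp
    moreover have "(x + (- (x $ i + 1) / d $ i) *\<^sub>R d) $ i \<ge> 0" using * by (rule nonneg)
    ultimately show False by linarith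
  qed
  have "d $ 1 = 0" "d $ 2 = 0" "d $ 3 = 0" "d $ 4 = 0"
    by (rule zero, simp add: mem_U4_iff)+
  then show "d = 0" by (simp add: vec_eq_iff forall_4)
qed

lemma aff_dim_kw_face:
  assumes "S \<subseteq> kw_index"
  shows "card S = 3 \<Longrightarrow> aff_dim (kw_face S) \<le> 1"
    and "card S = 2 \<Longrightarrow> aff_dim (kw_face S) \<le> 2"
proof -
  have fin: "finite S" if "S \<subseteq> kw_index" for S using that KW.finite_rows by (rule finite_subset)
  have 4: "aff_dim (kw_face S) \<le> 0" if S: "S \<subseteq> kw_index" "card S = 4" for S
  proof (cases "kw_face S = {}")
    case False
    then obtain x where x: "x \<in> kw_face S" by blast
    obtain T where T: "T \<in> set kw_vertices" "set T = S" using x S by (rule kw_face_4)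
    have "kw_face S = {kw_point T}" using kw_face_vertex[OF T(1)] T(2) by simp
    then show ?thesis by simp
  qed simp
  have 3: "aff_dim (kw_face S) \<le> 1" if S: "S \<subseteq> kw_index" "card S = 3" for S
  proof -
    have "aff_dim (kw_face S) \<le> 0 + 1"
    proof (rule KW.aff_dim_tight_face_le[OF linefree_U4 S(1)])
      fix j assume "j \<in> kw_index - S"
      then show "aff_dim (kw_face (insert j S)) \<le> 0" using S fin[OF S(1)] by (intro 4) simp_all
    qed simp
    then show ?thesis by simp
  qed
  have 2: "aff_dim (kw_face S) \<le> 2" if S: "S \<subseteq> kw_index" "card S = 2" for S
  proof -
    have "aff_dim (kw_face S) \<le> 1 + 1"
    proof (rule KW.aff_dim_tight_face_le[OF linefree_U4 S(1)])
      fix j assume "j \<in> kw_index - S"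
      then show "aff_dim (kw_face (insert j S)) \<le> 1" using S fin[OF S(1)] by (intro 3) simp_all
    qed simp
    then show ?thesis by simp
  qed
  show "card S = 3 \<Longrightarrow> aff_dim (kw_face S) \<le> 1"
    "card S = 2 \<Longrightarrow> aff_dim (kw_face S) \<le> 2"
    using 3 2 assms by simp_all
qed

lemma extreme_point_U4:
  assumes "x extreme_point_of U4"
  obtains T where "T \<in> set kw_vertices" "x = kw_point T"
proof -
  have "4 \<le> card {i \<in> kw_index. kw_row i \<bullet> x = kw_rhs i}"
    using KW.card_tight_extreme_point[OF assms] by simp
  then obtain S where S: "S \<subseteq> {i \<in> kw_index. kw_row i \<bullet> x = kw_rhs i}" "card S = 4"
    by (rule obtain_subset_with_card_n)
  have "x \<in> U4" using assms by (simp add: extreme_point_of_def)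
  moreover have "\<forall>i\<in>S. kw_row i \<bullet> x = kw_rhs i" using S(1) by blast
  ultimately have "x \<in> kw_face S" by (simp add: KW.tight_face_def)
  moreover have "S \<subseteq> kw_index" using S(1) by blast
  ultimately obtain T where "T \<in> set kw_vertices" "set T = S" "x = kw_point T"
    using S(2) by (rule kw_face_4)
  then show ?thesis by (intro that)
qed

definition kw_adjacent :: "nat list \<Rightarrow> nat list list" where
  "kw_adjacent T = filter (\<lambda>T'. length (filter (\<lambda>i. i \<in> set T') T) = 3) kw_vertices"

definition kw_expand :: "nat list list \<Rightarrow> nat list list" where
  "kw_expand Ts = remdups (Ts @ concat (map kw_adjacent Ts))"

fun kw_within :: "nat \<Rightarrow> nat list \<Rightarrow> nat list list" where
  "kw_within 0 T = [T]"
| "kw_within (Suc n) T = kw_expand (kw_within n T)"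

lemma kw_within_subset: "T \<in> set kw_vertices \<Longrightarrow> set (kw_within n T) \<subseteq> set kw_vertices"
  by (induction n) (auto simp: kw_adjacent_def kw_expand_def)

lemma kw_within_4:
  "\<forall>T\<in>set kw_vertices. set kw_vertices \<subseteq> set (kw_within 4 T @
    (if T = [5,6,7,8] then [[1,2,3,4]] else if T = [1,2,3,4] then [[5,6,7,8]] else []))"
  by code_simp

lemma kw_within_2: "[1,4,7,8] \<in> set (kw_within 2 [5,6,7,8])" "[3,4,5,8] \<in> set (kw_within 2 [1,2,3,4])"
  by code_simp+

subsection \<open>Realizations\<close>

context inequality_system
begin

context
  fixes h :: "(real^4) set \<Rightarrow> (real^'n) set"
  assumes iso: "face_iso h U4 P" and lin: "linefree P"
begin

definition real_face :: "nat set \<Rightarrow> (real^'n) set" where "real_face S = h (kw_face S)"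

definition real_vertex :: "nat list \<Rightarrow> real^'n" where "real_vertex T = the_elem (real_face (set T))"

lemma face_of_real_face: "S \<subseteq> kw_index \<Longrightarrow> real_face S face_of P"
  unfolding real_face_def by (rule face_iso_face[OF iso KW.face_of_tight_face])

lemma real_face_mono: "S \<subseteq> S' \<Longrightarrow> S' \<subseteq> kw_index \<Longrightarrow> real_face S' \<subseteq> real_face S"
  unfolding real_face_def
  using KW.tight_face_mono face_iso_subset_iff[OF iso KW.face_of_tight_face KW.face_of_tight_face]
  by (metis order_trans)

lemma aff_dim_real_face_le:
  assumes "S \<subseteq> kw_index"
  shows "aff_dim (real_face S) \<le> aff_dim (kw_face S)"
  unfolding real_face_def
  by (rule aff_dim_face_iso_le[OF rows.polyhedron_poly lin KW.polyhedron_poly iso KW.face_of_tight_face[OF assms]])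

lemma real_face_vertex:
  assumes "T \<in> set kw_vertices"
  shows "real_face (set T) = {real_vertex T}"
proof -
  have T: "set T \<subseteq> kw_index" using bspec[OF kw_vertices_wf assms] by simp
  have "aff_dim (real_face (set T)) \<le> 0"
    using aff_dim_real_face_le[OF T] by (simp add: kw_face_vertex[OF assms])
  moreover have "real_face (set T) \<noteq> h {}"
    unfolding real_face_def
    using face_iso_eq_iff[OF iso KW.face_of_tight_face[OF T] empty_face_of]
    by (simp add: kw_face_vertex[OF assms])
  then have ne: "real_face (set T) \<noteq> {}" by (simp add: face_iso_empty[OF iso])
  then have "aff_dim (real_face (set T)) \<noteq> -1" by (simp add: aff_dim_empty)
  ultimately have "aff_dim (real_face (set T)) = 0"
    using aff_dim_geq[of "real_face (set T)"] by linarith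
  then obtain a where "real_face (set T) = {a}" by (auto simp: aff_dim_eq_0)
  then show ?thesis by (simp add: real_vertex_def)
qed

lemma real_vertex_extreme: "T \<in> set kw_vertices \<Longrightarrow> real_vertex T extreme_point_of P"
  using face_of_real_face[of "set T"] bspec[OF kw_vertices_wf, of T]
  by (simp add: real_face_vertex face_of_singleton)

lemma real_vertex_mem_iff:
  assumes T: "T \<in> set kw_vertices" and S: "S \<subseteq> kw_index"
  shows "real_vertex T \<in> real_face S \<longleftrightarrow> S \<subseteq> set T"
proof -
  have TI: "set T \<subseteq> kw_index" using bspec[OF kw_vertices_wf T] by simp
  have "real_vertex T \<in> real_face S \<longleftrightarrow> real_face (set T) \<subseteq> real_face S"
    by (simp add: real_face_vertex[OF T])
  also have "\<dots> \<longleftrightarrow> kw_face (set T) \<subseteq> kw_face S"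
    unfolding real_face_def
    by (rule face_iso_subset_iff[OF iso KW.face_of_tight_face[OF TI] KW.face_of_tight_face[OF S]])
  also have "\<dots> \<longleftrightarrow> S \<subseteq> set T"
    by (simp add: kw_face_vertex[OF T] kw_point_mem_iff[OF T S])
  finally show ?thesis .
qed

lemma extreme_point_is_real_vertex:
  assumes "u extreme_point_of P"
  obtains T where "T \<in> set kw_vertices" "u = real_vertex T"
proof -
  have u: "{u} face_of P" using assms by (simp add: face_of_singleton)
  obtain F where F: "F face_of U4" "h F = {u}" using iso u by (rule face_iso_surj)
  obtain k where k: "face_iso k P U4" "\<forall>F. F face_of U4 \<longrightarrow> k (h F) = F"
    using iso by (rule face_iso_inverse)
  have "k {u} = F" using k(2) F by auto
  then have "aff_dim F \<le> 0"
    using aff_dim_face_iso_le[OF KW.polyhedron_poly linefree_U4 rows.polyhedron_poly k(1) u] by simp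
  moreover have "F \<noteq> {}" using F(2) face_iso_empty[OF iso] by auto
  then have "aff_dim F \<noteq> -1" by (simp add: aff_dim_empty)
  ultimately have "aff_dim F = 0" using aff_dim_geq[of F] by linarith
  then obtain x where x: "F = {x}" by (auto simp: aff_dim_eq_0)
  then have "x extreme_point_of U4" using F(1) by (simp add: face_of_singleton)
  then obtain T where T: "T \<in> set kw_vertices" "x = kw_point T" by (rule extreme_point_U4)
  have "{u} = {real_vertex T}"
    using F(2) x T(2) real_face_vertex[OF T(1)] by (simp add: real_face_def kw_face_vertex[OF T(1)])
  then show ?thesis using T(1) by (intro that) simp_all
qed

lemma real_face_cover:
  assumes "S \<subseteq> kw_index" "G face_of P" "G \<subseteq> real_face S" "G \<noteq> real_face S" "G \<noteq> {}"
  obtains j where "j \<in> kw_index - S" "G \<subseteq> real_face (insert j S)"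
proof -
  note face = KW.face_of_tight_face[OF assms(1)]
  obtain F where F: "F face_of U4" "h F = G" using iso assms(2) by (rule face_iso_surj)
  have "F \<subseteq> kw_face S"
    using assms(3) face_iso_subset_iff[OF iso F(1) face] F(2) by (simp add: real_face_def)
  moreover have "F \<noteq> kw_face S" using assms(4) F(2) by (auto simp: real_face_def)
  moreover have "F \<noteq> {}" using assms(5) F(2) face_iso_empty[OF iso] by auto
  ultimately obtain j where j: "j \<in> kw_index - S" "F \<subseteq> kw_face (insert j S)"
    using F(1) assms(1) KW.proper_face_extra_tight[of F S] by metis
  have "insert j S \<subseteq> kw_index" using j(1) assms(1) by simp
  then have "G \<subseteq> real_face (insert j S)"
    using j(2) face_iso_subset_iff[OF iso F(1) KW.face_of_tight_face] F(2) by (simp add: real_face_def)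
  with j(1) show ?thesis by (rule that)
qed

lemma real_face_unbounded:
  assumes S: "S \<subseteq> kw_index" and T: "T \<in> set kw_vertices" "S \<subseteq> set T"
    and only: "\<forall>T'\<in>set kw_vertices. S \<subseteq> set T' \<longrightarrow> T' = T"
    and more: "x \<in> kw_face S" "x \<noteq> kw_point T"
  shows "\<not> bounded (real_face S)"
proof
  assume bounded: "bounded (real_face S)"
  note face = face_of_real_face[OF S]
  have "polyhedron (real_face S)"
    by (rule face_of_polyhedron_polyhedron[OF rows.polyhedron_poly face])
  then have "compact (real_face S)" "convex (real_face S)"
    using bounded by (simp_all add: polyhedron_imp_closed polyhedron_imp_convex compact_eq_bounded_closed)
  then have hull: "real_face S = convex hull {v. v extreme_point_of real_face S}"
    by (rule Krein_Milman_Minkowski)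
  have "v = real_vertex T" if v: "v extreme_point_of real_face S" for v
  proof -
    have vP: "v extreme_point_of P" and vS: "v \<in> real_face S"
      using v extreme_point_of_face[OF face] by simp_all
    obtain T' where T': "T' \<in> set kw_vertices" "v = real_vertex T'"
      using vP by (rule extreme_point_is_real_vertex)
    then have "S \<subseteq> set T'" using vS real_vertex_mem_iff[OF T'(1) S] by simp
    then show ?thesis using bspec[OF only T'(1)] T'(2) by simp
  qed
  then have "convex hull {v. v extreme_point_of real_face S} \<subseteq> convex hull {real_vertex T}"
    by (intro hull_mono) blast
  then have "real_face S \<subseteq> real_face (set T)"
    using hull by (simp add: real_face_vertex[OF T(1)])
  then have "kw_face S \<subseteq> kw_face (set T)"
    unfolding real_face_def
    using face_iso_subset_iff[OF iso KW.face_of_tight_face[OF S] KW.face_of_tight_face]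
      bspec[OF kw_vertices_wf T(1)] by simp
  then show False using more by (auto simp: kw_face_vertex[OF T(1)])
qed

lemma circuit_step_adjacent:
  assumes T: "T \<in> set kw_vertices" and T': "T' \<in> set (kw_adjacent T)"
  shows "circuit_step A b (real_vertex T) (real_vertex T')"
proof -
  have T'V: "T' \<in> set kw_vertices" and len: "length (filter (\<lambda>i. i \<in> set T') T) = 3"
    using T' by (simp_all add: kw_adjacent_def)
  have wf: "distinct T" "length T = 4" "set T \<subseteq> kw_index" using bspec[OF kw_vertices_wf T] by simp_all
  define S where "S = set (filter (\<lambda>i. i \<in> set T') T)"
  have card: "card S = 3" unfolding S_def using distinct_card[of "filter (\<lambda>i. i \<in> set T') T"] wf(1) len by simp
  have S: "S \<subseteq> set T" "S \<subseteq> set T'" by (auto simp: S_def)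
  have SI: "S \<subseteq> kw_index" using S(1) wf(3) by (rule order_trans)
  have "\<not> set T \<subseteq> set T'"
  proof
    assume "set T \<subseteq> set T'"
    then have "filter (\<lambda>i. i \<in> set T') T = T" by (intro filter_True) blast
    then show False using len wf(2) by simp
  qed
  then have ne: "real_vertex T' \<noteq> real_vertex T"
    using real_vertex_mem_iff[OF T'V wf(3)] by (auto simp: real_face_vertex[OF T])
  have "aff_dim (real_face S) \<le> 1"
    using aff_dim_real_face_le[OF SI] aff_dim_kw_face(1)[OF SI card] by linarith
  then show ?thesis
    using ne circuit_step_to_extreme_point[OF face_of_real_face[OF SI], of "real_vertex T" "real_vertex T'"]
      real_vertex_mem_iff[OF T SI] real_vertex_mem_iff[OF T'V SI] S real_vertex_extreme[OF T'V]
    by simp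
qed

lemma circuit_distance_within:
  assumes T: "T \<in> set kw_vertices"
  shows "T' \<in> set (kw_within n T) \<Longrightarrow> circuit_distance A b (real_vertex T) (real_vertex T') \<le> enat n"
proof (induction n arbitrary: T')
  case 0
  have "real_vertex T \<in> P" using real_vertex_extreme[OF T] by (simp add: extreme_point_of_def)
  then show ?case using 0 by (simp add: circuit_distance_refl)
next
  case (Suc n)
  have "T' \<in> set (kw_within n T) \<or> (\<exists>T''\<in>set (kw_within n T). T' \<in> set (kw_adjacent T''))"
    using Suc.prems by (simp add: kw_expand_def)
  then show ?case
  proof
    assume "T' \<in> set (kw_within n T)"
    then have "circuit_distance A b (real_vertex T) (real_vertex T') \<le> enat n" by (rule Suc.IH)
    also have "\<dots> \<le> enat (Suc n)" by simp
    finally show ?case .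
  next
    assume "\<exists>T''\<in>set (kw_within n T). T' \<in> set (kw_adjacent T'')"
    then obtain T'' where T'': "T'' \<in> set (kw_within n T)" "T' \<in> set (kw_adjacent T'')" by blast
    have V: "T'' \<in> set kw_vertices" using kw_within_subset[OF T] T''(1) by blast
    have "T' \<in> set kw_vertices" using T''(2) by (simp add: kw_adjacent_def)
    then have "real_vertex T' \<in> P" using real_vertex_extreme by (simp add: extreme_point_of_def)
    then show ?case
      using circuit_distance_step[OF Suc.IH[OF T''(1)] circuit_step_adjacent[OF V T''(2)]] by simp
  qed
qed

lemma real_shortcut:
  assumes ij: "{i, j} \<subseteq> kw_index" "i \<noteq> j"
    and V: "set [Tq, T0, T1, T2, T3] \<subseteq> set kw_vertices"
    and kw: "kw_index - {i, j} = {jm, j0, j1, j2, km, kp}"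
    and new: "distinct [i, j, jm, j0, j1, j2, km, kp]"
    and Tq: "set Tq = {i, j, km, jm}" and T0: "set T0 = {i, j, jm, j0}" and T1: "set T1 = {i, j, j0, j1}"
    and T2: "set T2 = {i, j, j1, j2}" and T3: "set T3 = {i, j, j2, kp}"
    and ray: "\<forall>T'\<in>set kw_vertices. {km, i, j} \<subseteq> set T' \<longrightarrow> T' = Tq"
      "x \<in> kw_face {km, i, j}" "x \<noteq> kw_point Tq"
    and start: "circuit_distance A b v (real_vertex T0) \<le> enat n"
  shows "circuit_distance A b v (real_vertex T3) \<le> enat (n + 2)"
proof -
  let ?E = "\<lambda>k. real_face {k, i, j}"
  have idx: "{k, i, j} \<subseteq> kw_index" if "k \<in> {jm, j0, j1, j2, km, kp}" for k
    using ij(1) kw that by auto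
  have VV: "Tq \<in> set kw_vertices" "T0 \<in> set kw_vertices" "T1 \<in> set kw_vertices"
    "T2 \<in> set kw_vertices" "T3 \<in> set kw_vertices" using V by simp_all
  have new': "distinct (rev [i, j, jm, j0, j1, j2, km, kp])" using new by (simp only: distinct_rev)
  have dim: "aff_dim (?E k) \<le> 1" if k: "k \<in> {jm, j0, j1, j2, km, kp}" for k
  proof -
    have "k \<noteq> i" "k \<noteq> j" using k new by auto
    then have "card {k, i, j} = 3" using ij(2) by simp
    then show ?thesis
      using aff_dim_real_face_le[OF idx[OF k]] aff_dim_kw_face(1)[OF idx[OF k]] by linarith
  qed
  have "card {i, j} = 2" using ij(2) by simp
  then have dimF: "aff_dim (real_face {i, j}) \<le> 2"
    using aff_dim_real_face_le[OF ij(1)] aff_dim_kw_face(2)[OF ij(1)] by linarith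
  have sub: "?E k \<subseteq> real_face {i, j}" if k: "k \<in> {jm, j0, j1, j2, km, kp}" for k
    by (rule real_face_mono[OF _ idx[OF k]]) blast
  have faces: "?E k face_of P" if k: "k \<in> {jm, j0, j1, j2, km, kp}" for k
    by (rule face_of_real_face[OF idx[OF k]])
  have mem: "real_vertex T \<in> ?E k \<longleftrightarrow> {k, i, j} \<subseteq> set T"
    if "T \<in> set kw_vertices" "k \<in> {jm, j0, j1, j2, km, kp}" for T k
    using that(1) idx[OF that(2)] by (rule real_vertex_mem_iff)
  show ?thesis
  proof (rule unbounded_face_shortcut[where F = "real_face {i, j}" and em = "?E jm" and ?e0.0 = "?E j0"
        and ?e1.0 = "?E j1" and ?e2.0 = "?E j2" and rm = "?E km" and rp = "?E kp"
        and q = "real_vertex Tq" and ?p0.0 = "real_vertex T0" and ?p1.0 = "real_vertex T1"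
        and ?p2.0 = "real_vertex T2"])
    show "real_face {i, j} face_of P" by (rule face_of_real_face[OF ij(1)])
    show "G \<subseteq> ?E jm \<or> G \<subseteq> ?E j0 \<or> G \<subseteq> ?E j1 \<or> G \<subseteq> ?E j2 \<or> G \<subseteq> ?E km \<or> G \<subseteq> ?E kp"
      if G: "G face_of P" "G \<subseteq> real_face {i, j}" "G \<noteq> real_face {i, j}" "G \<noteq> {}" for G
    proof -
      obtain k where k: "k \<in> kw_index - {i, j}" "G \<subseteq> ?E k"
        using ij(1) G by (rule real_face_cover)
      from k(1) have "k = jm \<or> k = j0 \<or> k = j1 \<or> k = j2 \<or> k = km \<or> k = kp"
        unfolding kw by simp
      then show ?thesis using k(2) by (elim disjE) simp_all
    qed
    show "\<not> bounded (?E km)"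
      using idx _ _ ray by (rule real_face_unbounded) (simp_all add: VV Tq)
  qed (use new new' dimF start in \<open>simp_all add: faces sub dim mem VV real_vertex_extreme Tq T0 T1 T2 T3\<close>)
qed

end

end

theorem theorem26:
  fixes A' :: "real^4^'m::finite" and b' :: "real^'m"
  assumes "irredundant A' b'"
    and "aff_dim (polyhedron_of A' b') = 4"
    and "combinatorially_equivalent (polyhedron_of A' b') U4"
  shows "circuit_diameter A' b' \<le> 4"
proof -
  interpret inequality_system A' b' .
  obtain f where f: "face_iso f P U4" using assms(3) by (auto simp: combinatorially_equivalent_iff)
  obtain h where h: "face_iso h U4 P" using f by (rule face_iso_inverse)
  have "circuit_distance A' b' u v \<le> 4" if u: "u extreme_point_of P" and v: "v extreme_point_of P" for u v
  proof -
    note hl = h linefree_of_extreme_point[OF u]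
    obtain T where T: "T \<in> set kw_vertices" "u = real_vertex h T"
      using hl u by (rule extreme_point_is_real_vertex)
    obtain T' where T': "T' \<in> set kw_vertices" "v = real_vertex h T'"
      using hl v by (rule extreme_point_is_real_vertex)
    consider "T' \<in> set (kw_within 4 T)" | "T = [5,6,7,8]" "T' = [1,2,3,4]" | "T = [1,2,3,4]" "T' = [5,6,7,8]"
      using subsetD[OF bspec[OF kw_within_4 T(1)] T'(1)] by (auto split: if_splits)
    then have "circuit_distance A' b' (real_vertex h T) (real_vertex h T') \<le> enat 4"
    proof cases
      case 1
      then show ?thesis by (rule circuit_distance_within[OF hl T(1)])
    next
      case 2
      have "circuit_distance A' b' (real_vertex h T) (real_vertex h [1,4,7,8]) \<le> enat 2"
        using kw_within_2(1) unfolding 2 by (rule circuit_distance_within[OF hl T(1)[unfolded 2]])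
      then have "circuit_distance A' b' (real_vertex h T) (real_vertex h [1,2,3,4]) \<le> enat (2 + 2)"
      proof (rule real_shortcut[OF hl, of 1 4 "[1,4,6,7]" "[1,4,7,8]" "[1,4,5,8]" "[1,3,4,5]" "[1,2,3,4]"
            7 8 5 3 6 2 "vector [11/9, 0, 3, 19/3]", rotated -1])
        show "vector [11/9, 0, 3, 19/3] \<in> kw_face {6, 1, 4}"
          by (simp add: KW.tight_face_def mem_U4_iff kw_row_inner kw_rhs_simps vector_def)
        have "kw_face {6, 1, 4, 7} = {kw_point [1,4,6,7]}"
          using kw_face_vertex[of "[1,4,6,7]"] by (simp add: kw_vertices_def insert_commute)
        moreover have "vector [11/9, 0, 3, 19/3] \<notin> kw_face {6, 1, 4, 7}"
          by (simp add: KW.tight_face_def kw_row_inner kw_rhs_simps vector_def)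
        ultimately show "vector [11/9, 0, 3, 19/3] \<noteq> kw_point [1,4,6,7]" by auto
      qed (auto simp: kw_vertices_def kw_index_def)
      then show ?thesis by (simp add: 2)
    next
      case 3
      have "circuit_distance A' b' (real_vertex h T) (real_vertex h [3,4,5,8]) \<le> enat 2"
        using kw_within_2(2) unfolding 3 by (rule circuit_distance_within[OF hl T(1)[unfolded 3]])
      then have "circuit_distance A' b' (real_vertex h T) (real_vertex h [5,6,7,8]) \<le> enat (2 + 2)"
      proof (rule real_shortcut[OF hl, of 5 8 "[1,4,5,8]" "[3,4,5,8]" "[2,3,5,8]" "[2,5,7,8]" "[5,6,7,8]"
            4 3 2 7 1 6 "vector [0, 1/3, 20/9, 0]", rotated -1])
        show "vector [0, 1/3, 20/9, 0] \<in> kw_face {1, 5, 8}"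
          by (simp add: KW.tight_face_def mem_U4_iff kw_row_inner kw_rhs_simps vector_def)
        have "kw_face {1, 5, 8, 4} = {kw_point [1,4,5,8]}"
          using kw_face_vertex[of "[1,4,5,8]"] by (simp add: kw_vertices_def insert_commute)
        moreover have "vector [0, 1/3, 20/9, 0] \<notin> kw_face {1, 5, 8, 4}"
          by (simp add: KW.tight_face_def kw_row_inner kw_rhs_simps vector_def)
        ultimately show "vector [0, 1/3, 20/9, 0] \<noteq> kw_point [1,4,5,8]" by auto
      qed (auto simp: kw_vertices_def kw_index_def)
      then show ?thesis by (simp add: 3)
    qed
    then show ?thesis using T(2) T'(2) by (simp add: numeral_eq_enat)
  qed
  then show ?thesis unfolding circuit_diameter_def by (intro Sup_least) blast
qed

end
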